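(* There is a constant $C''_n>0$ depending only on $n$ such that the following holds. Let $\Omega\subset\mathbb H^n$ be an open, horizontally bounded and (Euclidean) convex set. If $u:\overline\Omega\to\mathbb R$ is a continuous $H$-convex function with $u=0$ on $\partial\Omega$, then $$|u(\xi)|^{2n}\le C''_n\,\mathcal D(\xi)\,\mathrm{diam}_{HS}(\Omega)^{2n-1}\,\mathcal L^{2n}_{HS}(\partial_Hu(\Omega))\qquad\forall\xi\in\Omega,$$ where $\mathcal D(\xi)=\min\{\mathrm{dist}_H(\zeta,\partial\Omega\cap H_\zeta):\zeta\in\overline{B_H(\xi,\mathrm{dist}_H(\xi,\partial\Omega)/3)}\}$.
   Context: $\mathbb H^n=\mathbb C^n\times\mathbb R\cong\mathbb R^{2n+1}$ with real coordinates $(x,y,t)$, $z=x+iy$, group law $(z,t)\circ(z',t')=(z+z',t+t'+2\,\mathrm{Im}\langle z,z'\rangle)$, $\langle z,z'\rangle=\sum_j z_j\overline{z'_j}$. Dilations $\delta_\lambda(z,t)=(\lambda z,\lambda^2t)$. Horizontal plane at $\xi_0=(x_0,y_0,t_0)$: $H_{\xi_0}=\{(x,y,t):t=t_0+2(x\cdot y_0-x_0\cdot y)\}$. $\mathrm{Pr}_1(x,y,t)=(x,y)$. Gauge $N(z,t)=(|z|^4+t^2)^{1/4}$, $d_H(\xi,\zeta)=N(\zeta^{-1}\circ\xi)$, $B_H(\xi,r)=\{\zeta:d_H(\zeta,\xi)<r\}$, $\mathrm{dist}_H(\xi,A)=\inf_{\zeta\in A}d_H(\xi,\zeta)$, $\mathrm{diam}_H$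 the $d_H$-diameter. $\mathrm{diam}_{HS}(\Omega)=\sup\{\mathrm{diam}_H(\Omega\cap H_\xi):\xi\in\Omega\}$; $\Omega$ is horizontally bounded if this is finite. A function $u$ on an $H$-convex set $\tilde\Omega$ is $H$-convex if $u(\xi_1\circ\delta_\lambda(\xi_1^{-1}\circ\xi_2))\le(1-\lambda)u(\xi_1)+\lambda u(\xi_2)$ for all $\xi_1,\xi_2\in\tilde\Omega$ with $\xi_1\in H_{\xi_2}$, $\lambda\in[0,1]$. For $\xi\in\Omega$, $\partial_Hu(\xi)=\{p\in\mathbb R^{2n}:u(\zeta)\ge u(\xi)+p\cdot(\mathrm{Pr}_1(\zeta)-\mathrm{Pr}_1(\xi))\ \forall\zeta\in\Omega\cap H_\xi\}$, $\partial_Hu(E)=\bigcup_{\xi\in E}\partial_Hu(\xi)$. $\mathcal L^{2n}_{HS}(\partial_Hu(\Omega))=\sup_{\xi\in\Omega}\mathcal L^{2n}(\partial_Hu(\Omega\cap H_\xi))$, $\mathcal L^{2n}$ Lebesgue measure on $\mathbb R^{2n}$. *)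

theory Defs
  imports "HOL-Analysis.Analysis"
begin

text \<open>Points of the Heisenberg group H^n = C^n x R, in real coordinates (x,y,t),
  with z = x + i y. The dimension n is CARD('n).\<close>
type_synonym 'n heis = "(real^'n) \<times> (real^'n) \<times> real"

text \<open>Group law: (z,t)(z',t') = (z+z', t+t'+2 Im<z,z'>), Im<z,z'> = x'.y - x.y'.\<close>
definition heis_mult :: "'n::finite heis \<Rightarrow> 'n heis \<Rightarrow> 'n heis" where
  "heis_mult p q = (case p of (x, y, t) \<Rightarrow> case q of (x', y', t') \<Rightarrow>
      (x + x', y + y', t + t' + 2 * (x' \<bullet> y - x \<bullet> y')))"

definition heis_inv :: "'n::finite heis \<Rightarrow> 'n heis" where
  "heis_inv p = (case p of (x, y, t) \<Rightarrow> (-x, -y, -t))"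

definition heis_dil :: "real \<Rightarrow> 'n::finite heis \<Rightarrow> 'n heis" where
  "heis_dil l p = (case p of (x, y, t) \<Rightarrow> (l *\<^sub>R x, l *\<^sub>R y, l\<^sup>2 * t))"

definition hplane :: "'n::finite heis \<Rightarrow> 'n heis set" where
  "hplane p0 = (case p0 of (x0, y0, t0) \<Rightarrow>
      {(x, y, t). t = t0 + 2 * (x \<bullet> y0 - x0 \<bullet> y)})"

definition Pr1 :: "'n::finite heis \<Rightarrow> (real^'n) \<times> (real^'n)" where
  "Pr1 p = (case p of (x, y, t) \<Rightarrow> (x, y))"

definition gauge :: "'n::finite heis \<Rightarrow> real" where
  "gauge p = (case p of (x, y, t) \<Rightarrow> (((norm x)\<^sup>2 + (norm y)\<^sup>2)\<^sup>2 + t\<^sup>2) powr (1/4))"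

definition dH :: "'n::finite heis \<Rightarrow> 'n heis \<Rightarrow> real" where
  "dH p q = gauge (heis_mult (heis_inv q) p)"

definition ballH :: "'n::finite heis \<Rightarrow> real \<Rightarrow> 'n heis set" where
  "ballH p r = {q. dH q p < r}"

definition distH :: "'n::finite heis \<Rightarrow> 'n heis set \<Rightarrow> real" where
  "distH p A = (INF q\<in>A. dH p q)"

definition diamH :: "'n::finite heis set \<Rightarrow> real" where
  "diamH A = (SUP pq\<in>A \<times> A. dH (fst pq) (snd pq))"

definition diamHS :: "'n::finite heis set \<Rightarrow> real" where
  "diamHS \<Omega> = (SUP p\<in>\<Omega>. diamH (\<Omega> \<inter> hplane p))"

text \<open>Horizontally bounded: diam_HS is finite, i.e. the horizontal sections have
  uniformly bounded d_H-diameter.\<close>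
definition horiz_bounded :: "'n::finite heis set \<Rightarrow> bool" where
  "horiz_bounded \<Omega> \<longleftrightarrow> (\<exists>M. \<forall>p\<in>\<Omega>. \<forall>a\<in>\<Omega> \<inter> hplane p. \<forall>b\<in>\<Omega> \<inter> hplane p. dH a b \<le> M)"

definition H_convex_on :: "'n::finite heis set \<Rightarrow> ('n heis \<Rightarrow> real) \<Rightarrow> bool" where
  "H_convex_on S u \<longleftrightarrow> (\<forall>p1\<in>S. \<forall>p2\<in>S. \<forall>l::real. p1 \<in> hplane p2 \<longrightarrow> 0 \<le> l \<longrightarrow> l \<le> 1 \<longrightarrow>
      u (heis_mult p1 (heis_dil l (heis_mult (heis_inv p1) p2))) \<le> (1 - l) * u p1 + l * u p2)"

definition subdiffH :: "'n::finite heis set \<Rightarrow> ('n heis \<Rightarrow> real) \<Rightarrow> 'n heis \<Rightarrow> ((real^'n) \<times> (real^'n)) set" where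
  "subdiffH \<Omega> u p = {v. \<forall>q\<in>\<Omega> \<inter> hplane p. u q \<ge> u p + v \<bullet> (Pr1 q - Pr1 p)}"

definition subdiffH_set :: "'n::finite heis set \<Rightarrow> ('n heis \<Rightarrow> real) \<Rightarrow> 'n heis set \<Rightarrow> ((real^'n) \<times> (real^'n)) set" where
  "subdiffH_set \<Omega> u E = (\<Union>p\<in>E. subdiffH \<Omega> u p)"

definition LHS_subdiff :: "'n::finite heis set \<Rightarrow> ('n heis \<Rightarrow> real) \<Rightarrow> ennreal" where
  "LHS_subdiff \<Omega> u = (SUP p\<in>\<Omega>. emeasure lebesgue (subdiffH_set \<Omega> u (\<Omega> \<inter> hplane p)))"

definition DH :: "'n::finite heis set \<Rightarrow> 'n heis \<Rightarrow> real" where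
  "DH \<Omega> p = (INF q\<in>closure (ballH p (distH p (frontier \<Omega>) / 3)).
                 distH q (frontier \<Omega> \<inter> hplane q))"

end

theory Submission
  imports Defs
begin

text \<open>Fix \<open>q \<in> \<Omega>\<close> with \<open>u q < 0\<close>, and let \<open>v\<close> be a slope whose affine function with value \<open>u q\<close> at \<open>q\<close>
  is negative on the boundary of the horizontal section of \<open>\<Omega>\<close> through \<open>q\<close>. Then \<open>v\<close> is a horizontal subgradient of \<open>u\<close>
  somewhere on that section. The directions along which \<open>u - v\<close> strictly descends, uniformly near
  a point, form a convex cone by a Trotter product argument, so if no point had the subgradient \<open>v\<close>, these
  directions could be glued to a field without zeros, which Brouwer's theorem excludes. These slopes
  contain a chain of about \<open>R / d\<close> disjoint balls of radius comparable to \<open>\<bar>u q\<bar> / R\<close>, where \<open>R\<close> is the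
  horizontal diameter and \<open>d\<close> the distance of \<open>q\<close> to a boundary point of the section; this gives the
  estimate at \<open>q\<close>. Finally, \<open>\<bar>u \<xi>\<bar> \<le> 32 * \<bar>u q\<bar>\<close> for all \<open>q\<close> in the ball over which \<open>DH\<close> is minimised.\<close>

section \<open>Horizontal translations\<close>

text \<open>The symplectic form \<open>Im <z, w>\<close> of the group law, with both arguments read
  as vectors of R^2n.\<close>

definition sympl :: "(real^'n) \<times> (real^'n) \<Rightarrow> (real^'n) \<times> (real^'n) \<Rightarrow> real" where
  "sympl z w = fst w \<bullet> snd z - fst z \<bullet> snd w"

definition heis_pt :: "(real^'n) \<times> (real^'n) \<Rightarrow> real \<Rightarrow> 'n::finite heis" where
  "heis_pt z t = (fst z, snd z, t)"

text \<open>Right multiplication by a horizontal element parametrises the horizontal plane at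
  \<open>p\<close> by the displacement \<open>h\<close> of the projection; slopes in R^2n then pair
  directly with \<open>h\<close>.\<close>

definition hshift :: "'n::finite heis \<Rightarrow> (real^'n) \<times> (real^'n) \<Rightarrow> 'n heis" where
  "hshift p h = heis_mult p (heis_pt h 0)"

lemma sympl_add_left: "sympl (a + b) c = sympl a c + sympl b c"
  by (simp add: sympl_def algebra_simps)

lemma sympl_add_right: "sympl a (b + c) = sympl a b + sympl a c"
  by (simp add: sympl_def algebra_simps)

lemma sympl_scaleR_left: "sympl (s *\<^sub>R a) b = s * sympl a b"
  by (simp add: sympl_def algebra_simps)

lemma sympl_scaleR_right: "sympl a (s *\<^sub>R b) = s * sympl a b"
  by (simp add: sympl_def algebra_simps)

lemma sympl_minus_left: "sympl (- a) b = - sympl a b"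
  using sympl_scaleR_left[of "-1"] by simp

lemma sympl_minus_right: "sympl a (- b) = - sympl a b"
  using sympl_scaleR_right[of _ "-1"] by simp

lemma sympl_zero [simp]: "sympl 0 a = 0" "sympl a 0 = 0"
  by (simp_all add: sympl_def)

lemma sympl_commute: "sympl b a = - sympl a b"
  by (simp add: sympl_def inner_commute)

lemma sympl_self [simp]: "sympl a a = 0"
  by (simp add: sympl_def inner_commute)

lemma sympl_diff_left: "sympl (a - b) c = sympl a c - sympl b c"
  by (simp add: sympl_def algebra_simps)

lemma sympl_diff_right: "sympl a (b - c) = sympl a b - sympl a c"
  by (simp add: sympl_def algebra_simps)

lemmas sympl_linear = sympl_add_left sympl_add_right sympl_scaleR_left sympl_scaleR_right
  sympl_minus_left sympl_minus_right sympl_diff_left sympl_diff_right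

text \<open>The form is the inner product of \<open>w\<close> with \<open>z\<close> rotated by the
  complex structure, which preserves norms.\<close>

lemma abs_sympl_le: "\<bar>sympl z w\<bar> \<le> norm z * norm w"
proof -
  have "sympl z w = w \<bullet> (snd z, - fst z)"
    by (simp add: sympl_def inner_prod_def inner_commute)
  also have "\<bar>\<dots>\<bar> \<le> norm w * norm (snd z, - fst z)"
    by (rule Cauchy_Schwarz_ineq2)
  also have "norm (snd z, - fst z) = norm z"
    by (simp add: norm_prod_def add.commute)
  finally show ?thesis by (simp add: mult.commute)
qed

lemma heis_pt_cases: obtains z t where "p = heis_pt z t"
  by (metis heis_pt_def prod.collapse fst_conv snd_conv)

lemma heis_pt_eq_iff [simp]: "heis_pt z t = heis_pt w s \<longleftrightarrow> z = w \<and> t = s"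
  by (auto simp: heis_pt_def prod_eq_iff)

lemma heis_pt_add: "heis_pt z t + heis_pt w s = heis_pt (z + w) (t + s)"
  by (simp add: heis_pt_def)

lemma heis_pt_scaleR: "l *\<^sub>R heis_pt z t = heis_pt (l *\<^sub>R z) (l * t)"
  by (simp add: heis_pt_def)

lemma heis_mult_pt: "heis_mult (heis_pt z t) (heis_pt w s) = heis_pt (z + w) (t + s + 2 * sympl z w)"
  by (simp add: heis_mult_def heis_pt_def sympl_def)

lemma heis_inv_pt: "heis_inv (heis_pt z t) = heis_pt (- z) (- t)"
  by (simp add: heis_inv_def heis_pt_def)

lemma heis_dil_pt: "heis_dil l (heis_pt z t) = heis_pt (l *\<^sub>R z) (l\<^sup>2 * t)"
  by (simp add: heis_dil_def heis_pt_def)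

lemma Pr1_pt [simp]: "Pr1 (heis_pt z t) = z"
  by (simp add: Pr1_def heis_pt_def)

lemma hshift_pt: "hshift (heis_pt z t) h = heis_pt (z + h) (t + 2 * sympl z h)"
  by (simp add: hshift_def heis_mult_pt)

lemma Pr1_hshift [simp]: "Pr1 (hshift p h) = Pr1 p + h"
  by (cases p rule: heis_pt_cases) (simp add: hshift_pt)

lemma hshift_0 [simp]: "hshift p 0 = p"
  by (cases p rule: heis_pt_cases) (simp add: hshift_pt)

lemma hshift_minus_cancel [simp]: "hshift (hshift p h) (- h) = p"
  by (cases p rule: heis_pt_cases) (simp add: hshift_pt sympl_linear)

lemma hshift_hshift_scaleR: "hshift (hshift p (a *\<^sub>R h)) (b *\<^sub>R h) = hshift p ((a + b) *\<^sub>R h)"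
  by (cases p rule: heis_pt_cases) (simp add: hshift_pt sympl_linear algebra_simps)

text \<open>Horizontal shifts commute with left translation by \<open>p\<close>, so paths can be
  computed in coordinates centred at \<open>p\<close>.\<close>

lemma hshift_mult_pt:
  "hshift (heis_mult p (heis_pt z t)) h = heis_mult p (heis_pt (z + h) (t + 2 * sympl z h))"
  by (cases p rule: heis_pt_cases) (simp add: hshift_pt heis_mult_pt sympl_linear algebra_simps)

lemma heis_mult_inv_cancel: "heis_mult p (heis_mult (heis_inv p) q) = q"
  by (cases p rule: heis_pt_cases; cases q rule: heis_pt_cases)
    (simp add: heis_inv_pt heis_mult_pt sympl_linear)

lemma heis_inv_mult_cancel: "heis_mult (heis_inv p) (heis_mult p q) = q"
  by (cases p rule: heis_pt_cases; cases q rule: heis_pt_cases)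
    (simp add: heis_inv_pt heis_mult_pt sympl_linear)

text \<open>For \<open>p = heis_pt z t\<close> the plane has the equation
  \<open>s = t + 2 * sympl z w\<close>, and \<open>sympl z w = sympl z (w - z)\<close> because
  \<open>sympl z z = 0\<close>.\<close>

lemma hplane_eq: "hplane p = range (hshift p)"
proof (cases p rule: heis_pt_cases)
  case (1 z t)
  have "q \<in> hplane p \<longleftrightarrow> q \<in> range (hshift p)" for q
  proof (cases q rule: heis_pt_cases)
    case (1 w s)
    have "q \<in> hplane p \<longleftrightarrow> s = t + 2 * sympl z w"
      unfolding 1 \<open>p = _\<close> by (simp add: hplane_def heis_pt_def sympl_def)
    also have "\<dots> \<longleftrightarrow> q = hshift p (w - z)"
      unfolding 1 \<open>p = _\<close>
      by (simp add: hshift_pt) (simp add: sympl_def algebra_simps inner_commute)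
    also have "\<dots> \<longleftrightarrow> q \<in> range (hshift p)"
    proof
      assume "q \<in> range (hshift p)"
      then obtain h where "q = hshift p h" by auto
      moreover from this have "h = w - z"
        unfolding 1 \<open>p = _\<close> by (simp add: hshift_pt)
      ultimately show "q = hshift p (w - z)" by simp
    qed simp
    finally show ?thesis .
  qed
  then show ?thesis by blast
qed

lemma hshift_in_hplane [simp]: "hshift p h \<in> hplane p"
  by (simp add: hplane_eq)

lemma hplaneE:
  assumes "q \<in> hplane p"
  obtains h where "q = hshift p h"
  using assms by (auto simp: hplane_eq)

text \<open>Horizontal segments are Euclidean segments; this links Euclidean convexity of the domain
  with H-convexity of functions.\<close>

lemma hshift_convex_comb: "hshift p (l *\<^sub>R h) = (1 - l) *\<^sub>R p + l *\<^sub>R hshift p h"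
  by (cases p rule: heis_pt_cases)
    (simp add: hshift_pt sympl_linear heis_pt_add heis_pt_scaleR algebra_simps)

lemma hshift_affine: "hshift p ((1 - l) *\<^sub>R h + l *\<^sub>R k) = (1 - l) *\<^sub>R hshift p h + l *\<^sub>R hshift p k"
  by (cases p rule: heis_pt_cases)
    (simp add: hshift_pt sympl_linear heis_pt_add heis_pt_scaleR algebra_simps)

text \<open>Being in each other's horizontal plane is a symmetric relation, and a dilation by
  \<open>l\<close> merely rescales a horizontal displacement by \<open>l\<close>.\<close>

lemma H_convex_onD:
  assumes "H_convex_on S u" "p \<in> S" "hshift p h \<in> S" "0 \<le> l" "l \<le> 1"
  shows "u (hshift p (l *\<^sub>R h)) \<le> (1 - l) * u p + l * u (hshift p h)"
proof -
  have "p \<in> hplane (hshift p h)"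
    using hshift_in_hplane[of "hshift p h" "- h"] by simp
  moreover have "heis_mult p (heis_dil l (heis_mult (heis_inv p) (hshift p h))) = hshift p (l *\<^sub>R h)"
    unfolding hshift_def heis_inv_mult_cancel by (simp add: heis_dil_pt)
  ultimately show ?thesis
    using assms unfolding H_convex_on_def by metis
qed

section \<open>Continuity of the group operations\<close>

lemma continuous_on_heis_mult [continuous_intros]:
  assumes "continuous_on S f" "continuous_on S g"
  shows "continuous_on S (\<lambda>x. heis_mult (f x) (g x))"
  unfolding heis_mult_def case_prod_beta by (intro continuous_intros assms)

lemma continuous_on_heis_inv [continuous_intros]:
  assumes "continuous_on S f"
  shows "continuous_on S (\<lambda>x. heis_inv (f x))"
  unfolding heis_inv_def case_prod_beta by (intro continuous_intros assms)

lemma continuous_on_heis_pt [continuous_intros]: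
  assumes "continuous_on S f" "continuous_on S g"
  shows "continuous_on S (\<lambda>x. heis_pt (f x) (g x))"
  unfolding heis_pt_def by (intro continuous_intros assms)

lemma continuous_on_hshift [continuous_intros]:
  assumes "continuous_on S f" "continuous_on S g"
  shows "continuous_on S (\<lambda>x. hshift (f x) (g x))"
  unfolding hshift_def by (intro continuous_intros assms)

lemma continuous_on_Pr1 [continuous_intros]:
  assumes "continuous_on S f"
  shows "continuous_on S (\<lambda>x. Pr1 (f x))"
  unfolding Pr1_def case_prod_beta by (intro continuous_intros assms)

section \<open>Gauge and distance in coordinates\<close>

lemma gauge_pt: "gauge (heis_pt z t) = ((norm z) ^ 4 + t\<^sup>2) powr (1/4)"
proof -
  have "((norm (fst z))\<^sup>2 + (norm (snd z))\<^sup>2)\<^sup>2 = norm z ^ 4"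
    by (simp add: norm_prod_def power4_eq_xxxx power2_eq_square)
  then show ?thesis by (simp add: gauge_def heis_pt_def)
qed

lemma gauge_eq_root: "gauge (heis_pt z t) = root 4 ((norm z) ^ 4 + t\<^sup>2)"
  by (simp add: gauge_pt root_powr_inverse)

lemma gauge_pt_less_iff: "0 < r \<Longrightarrow> gauge (heis_pt z t) < r \<longleftrightarrow> (norm z) ^ 4 + t\<^sup>2 < r ^ 4"
  by (metis gauge_eq_root real_root_less_iff real_root_pos2 zero_less_numeral less_imp_le)

lemma gauge_pt_le_iff: "0 \<le> r \<Longrightarrow> gauge (heis_pt z t) \<le> r \<longleftrightarrow> (norm z) ^ 4 + t\<^sup>2 \<le> r ^ 4"
  by (metis gauge_eq_root real_root_le_iff real_root_pos2 zero_less_numeral)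

lemma gauge_horizontal [simp]: "gauge (heis_pt h 0) = norm h"
  by (simp add: gauge_eq_root real_root_pos2)

lemma continuous_on_gauge: "continuous_on S (gauge :: 'n::finite heis \<Rightarrow> real)"
proof -
  have "gauge = (\<lambda>p::'n heis. root 4 ((norm (Pr1 p)) ^ 4 + (snd (snd p))\<^sup>2))"
    by (rule ext) (metis gauge_eq_root heis_pt_cases Pr1_pt heis_pt_def snd_conv)
  moreover have "continuous_on S (\<lambda>p::'n heis. root 4 ((norm (Pr1 p)) ^ 4 + (snd (snd p))\<^sup>2))"
    by (intro continuous_intros)
  ultimately show ?thesis by (simp only:)
qed

text \<open>The distance is left invariant and the gauge is unchanged under inversion.\<close>

lemma dH_mult_left: "dH p (heis_mult p q) = gauge q"
proof (cases p rule: heis_pt_cases; cases q rule: heis_pt_cases)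
  fix z t w s
  assume p: "p = heis_pt z t" and q: "q = heis_pt w s"
  have "heis_mult (heis_inv (heis_mult p q)) p = heis_pt (- w) (- s)"
    unfolding p q by (simp add: heis_inv_pt heis_mult_pt sympl_linear sympl_commute[of w z])
  then show ?thesis by (simp add: dH_def q gauge_eq_root)
qed

lemma dH_hshift [simp]: "dH p (hshift p h) = norm h"
  by (simp add: hshift_def dH_mult_left)

lemma dH_nonneg [simp]: "0 \<le> dH p q"
  by (simp add: dH_def gauge_def split: prod.split)

section \<open>Descent directions\<close>

text \<open>The rate \<open>c\<close> is uniform over base points near \<open>p\<close>. This makes
  the condition open in \<open>p\<close> and lets short steps from moving base points be
  concatenated.\<close>

definition descends :: "('n::finite heis \<Rightarrow> real) \<Rightarrow> 'n heis \<Rightarrow> (real^'n) \<times> (real^'n) \<Rightarrow> bool" where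
  "descends w p h \<longleftrightarrow>
     (\<exists>c>0. \<exists>e>0. \<forall>p'\<in>ball p e. \<forall>s\<in>{0..e}. w (hshift p' (s *\<^sub>R h)) \<le> w p' - c * s)"

lemma not_descends_0: "\<not> descends w p 0"
proof
  assume "descends w p 0"
  then obtain c e where ce: "0 < c" "0 < e"
    "\<And>p' s. p' \<in> ball p e \<Longrightarrow> s \<in> {0..e} \<Longrightarrow> w (hshift p' (s *\<^sub>R 0)) \<le> w p' - c * s"
    unfolding descends_def by blast
  have "w (hshift p (e *\<^sub>R 0)) \<le> w p - c * e"
    using ce(1,2) by (intro ce(3)) auto
  then show False using mult_pos_pos[OF ce(1,2)] by simp
qed

lemma descends_scaleR:
  assumes "descends w p h" "0 < a"
  shows "descends w p (a *\<^sub>R h)"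
proof -
  obtain c e where ce: "0 < c" "0 < e"
    "\<And>p' s. p' \<in> ball p e \<Longrightarrow> s \<in> {0..e} \<Longrightarrow> w (hshift p' (s *\<^sub>R h)) \<le> w p' - c * s"
    using assms(1) unfolding descends_def by blast
  have "w (hshift p' (s *\<^sub>R (a *\<^sub>R h))) \<le> w p' - (c * a) * s"
    if "p' \<in> ball p (min e (e / a))" "s \<in> {0..min e (e / a)}" for p' s
  proof -
    have "s * a \<in> {0..e}" using that assms(2) by (auto simp: field_simps)
    from ce(3)[OF _ this, of p'] that show ?thesis by (simp add: mult.assoc mult.commute[of a s])
  qed
  moreover have "0 < c * a" "0 < min e (e / a)" using ce assms(2) by auto
  ultimately show ?thesis unfolding descends_def by blast
qed

text \<open>Half the radius serves all base points within half the radius of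
  \<open>p\<close>.\<close>

lemma open_descends: "open {p. descends w p h}"
  unfolding open_contains_ball
proof
  fix p assume "p \<in> {p. descends w p h}"
  then obtain c e where ce: "0 < c" "0 < e"
    "\<And>p' s. p' \<in> ball p e \<Longrightarrow> s \<in> {0..e} \<Longrightarrow> w (hshift p' (s *\<^sub>R h)) \<le> w p' - c * s"
    unfolding descends_def by blast
  have "descends w q h" if "q \<in> ball p (e / 2)" for q
  proof -
    have "ball q (e / 2) \<subseteq> ball p e"
    proof
      fix x assume "x \<in> ball q (e / 2)"
      then show "x \<in> ball p e" using that dist_triangle[of p x q] by simp
    qed
    then have "\<forall>p'\<in>ball q (e / 2). \<forall>s\<in>{0..e / 2}. w (hshift p' (s *\<^sub>R h)) \<le> w p' - c * s"
      using ce by auto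
    then show ?thesis unfolding descends_def using ce(1,2) half_gt_zero by blast
  qed
  then show "\<exists>e>0. ball p e \<subseteq> {p. descends w p h}"
    using ce(2) by (intro exI[of _ "e / 2"]) auto
qed

text \<open>Following \<open>h\<close> and \<open>k\<close> alternately in small steps approximates the direction \<open>h + k\<close>;
  the vertical drift produced by the commutators tends to zero with the step size.\<close>
lemma descends_add:
  fixes w :: "'n::finite heis \<Rightarrow> real"
  assumes "open \<Omega>" "continuous_on \<Omega> w" "p \<in> \<Omega>" and h: "descends w p h" and k: "descends w p k"
  shows "descends w p (h + k)"
proof -
  obtain c1 e1 where 1: "0 < c1" "0 < e1"
    "\<And>p' s. p' \<in> ball p e1 \<Longrightarrow> s \<in> {0..e1} \<Longrightarrow> w (hshift p' (s *\<^sub>R h)) \<le> w p' - c1 * s"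
    using h unfolding descends_def by blast
  obtain c2 e2 where 2: "0 < c2" "0 < e2"
    "\<And>p' s. p' \<in> ball p e2 \<Longrightarrow> s \<in> {0..e2} \<Longrightarrow> w (hshift p' (s *\<^sub>R k)) \<le> w p' - c2 * s"
    using k unfolding descends_def by blast
  obtain r where r: "0 < r" "ball p r \<subseteq> \<Omega>"
    using assms openE by blast
  define m where "m = min r (min e1 e2)"
  have m: "0 < m" "m \<le> r" "m \<le> e1" "m \<le> e2"
    using 1 2 r by (auto simp: m_def)
  \<comment> \<open>\<open>a\<close> and \<open>b\<close> are the times spent along \<open>h\<close>
    and \<open>k\<close>, and \<open>c\<close> measures the vertical drift.
    \<open>F (q, s, s, 0)\<close> is the target
    \<open>hshift q (s *\<^sub>R (h + k))\<close>.\<close>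
  define F where "F = (\<lambda>(q, a, b, c). heis_mult q (heis_pt (a *\<^sub>R h + b *\<^sub>R k) (2 * c * sympl h k)))"
  have F: "F (q, a, b, c) = heis_mult q (heis_pt (a *\<^sub>R h + b *\<^sub>R k) (2 * c * sympl h k))" for q a b c
    by (simp add: F_def)
  have contF: "continuous_on UNIV F"
    unfolding F_def case_prod_beta by (intro continuous_intros)
  have F0: "F (p, 0, 0, 0) = p"
    using hshift_0[of p] by (simp add: F hshift_def)
  obtain d where d: "0 < d" "\<And>x. dist x (p, 0, 0, 0) < d \<Longrightarrow> dist (F x) p < m"
  proof -
    have "\<exists>d>0. \<forall>x\<in>UNIV. dist x (p, 0, 0, 0) < d \<longrightarrow> dist (F x) (F (p, 0, 0, 0)) < m"
      using contF m(1) unfolding continuous_on_iff by blast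
    then show ?thesis using that unfolding F0 by blast
  qed
  \<comment> \<open>The quarter of \<open>d\<close> serves the four components of the argument of
    \<open>F\<close>; the bound 1 keeps the drift parameter below the elapsed time.\<close>
  define e where "e = min 1 (min m (d / 4))"
  have e: "0 < e" "e \<le> 1" "e \<le> m" "e \<le> d / 4"
    using m d by (auto simp: e_def)
  have near: "F (q, a, b, c) \<in> ball p m"
    if "q \<in> ball p e" "a \<in> {0..e}" "b \<in> {0..e}" "c \<in> {0..e}" for q a b c
  proof -
    have "dist (q, a, b, c) (p, 0, 0, 0) = norm (q - p, a, b, c)"
      by (simp add: dist_norm)
    also have "\<dots> \<le> norm (q - p) + (norm a + (norm b + norm c))"
      by (meson add_left_mono norm_Pair_le order_trans)
    also have "\<dots> < d"
      using that e by (simp add: dist_norm norm_minus_commute)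
    finally show ?thesis using d(2) by (simp add: dist_commute)
  qed
  have "w (hshift q (s *\<^sub>R (h + k))) \<le> w q - (c1 + c2) * s" if q: "q \<in> ball p e" and s: "s \<in> {0..e}" for q s
  proof -
    \<comment> \<open>Here \<open>n = Suc N\<close> rounds of step length \<open>g = s / n\<close>
      are made; they end with drift parameter \<open>n * g\<^sup>2 = s\<^sup>2 / n\<close>.\<close>
    have "w (F (q, s, s, s\<^sup>2 / real (Suc N))) \<le> w q - (c1 + c2) * s" for N
    proof -
      define n where "n = Suc N"
      define g where "g = s / n"
      have g: "0 \<le> g" "n * g = s" using s by (auto simp: g_def n_def)
      have step: "j * g \<in> {0..e}" "j * g\<^sup>2 \<in> {0..e}" if "j \<le> n" for j :: nat
      proof -
        have *: "j * g \<le> s" using that g by (metis mult_right_mono of_nat_mono)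
        then show "j * g \<in> {0..e}" using s g by auto
        have "g \<le> s"
          using g by (metis n_def mult_le_cancel_right1 of_nat_1 of_nat_le_iff le_add1 plus_1_eq_Suc mult.commute linorder_not_le)
        then have "(j * g) * g \<le> s * 1"
          using * g s e by (intro mult_mono) auto
        then have "j * g\<^sup>2 \<le> s" by (simp add: power2_eq_square mult.assoc)
        then show "j * g\<^sup>2 \<in> {0..e}" using s by auto
      qed
      have "w (F (q, j * g, j * g, j * g\<^sup>2)) \<le> w q - (c1 + c2) * (j * g)" if "j \<le> n" for j :: nat
        using that
      proof (induction j)
        case 0
        then show ?case using hshift_0[of q] by (simp add: F hshift_def)
      next
        case (Suc j)
        let ?P = "F (q, j * g, j * g, j * g\<^sup>2)"
        let ?Q = "F (q, Suc j * g, j * g, 0)"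
        \<comment> \<open>By antisymmetry of \<open>sympl\<close>, the step along \<open>h\<close>
          cancels the drift accumulated so far. The step along \<open>k\<close> then restores it
          with one more unit, so that it grows only linearly in \<open>j\<close>.\<close>
        have PQ: "hshift ?P (g *\<^sub>R h) = ?Q"
          unfolding F by (simp add: hshift_mult_pt sympl_linear algebra_simps power2_eq_square sympl_commute[of k h])
        have QR: "hshift ?Q (g *\<^sub>R k) = F (q, Suc j * g, Suc j * g, Suc j * g\<^sup>2)"
          unfolding F by (simp add: hshift_mult_pt sympl_linear algebra_simps power2_eq_square)
        have ge: "g \<in> {0..e}" using step(1)[of 1] by (simp add: n_def)
        have "?P \<in> ball p m" using q step[of j] Suc by (intro near) auto
        then have "w ?Q \<le> w ?P - c1 * g"
          using 1(3)[of ?P g] ge m e unfolding PQ by auto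
        moreover have "?Q \<in> ball p m" using q step[of j] step[of "Suc j"] Suc e by (intro near) auto
        then have "w (F (q, Suc j * g, Suc j * g, Suc j * g\<^sup>2)) \<le> w ?Q - c2 * g"
          using 2(3)[of ?Q g] ge m e unfolding QR by auto
        ultimately show ?case using Suc by (simp add: algebra_simps)
      qed
      from this[of n] g show ?thesis
        by (simp add: n_def g_def power2_eq_square)
    qed
    moreover have "(\<lambda>N. w (F (q, s, s, s\<^sup>2 / real (Suc N)))) \<longlonglongrightarrow> w (F (q, s, s, 0))"
    proof -
      have "F (q, s, s, 0) \<in> \<Omega>" using near[OF q s s, of 0] e m r by auto
      then have "isCont w (F (q, s, s, 0))"
        using assms(1,2) continuous_on_eq_continuous_at by blast
      moreover have "(\<lambda>N. F (q, s, s, s\<^sup>2 / real (Suc N))) \<longlonglongrightarrow> F (q, s, s, 0)"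
      proof (rule continuous_on_tendsto_compose[OF contF])
        have "(\<lambda>N. s\<^sup>2 * inverse (real (Suc N))) \<longlonglongrightarrow> s\<^sup>2 * 0"
          by (intro tendsto_intros LIMSEQ_inverse_real_of_nat)
        then show "(\<lambda>N. (q, s, s, s\<^sup>2 / real (Suc N))) \<longlonglongrightarrow> (q, s, s, 0)"
          by (intro tendsto_intros) (simp add: field_simps)
      qed auto
      ultimately show ?thesis by (rule isCont_tendsto_compose)
    qed
    ultimately have "w (F (q, s, s, 0)) \<le> w q - (c1 + c2) * s"
      by (intro LIMSEQ_le_const2) auto
    then show ?thesis by (simp add: F hshift_def scaleR_add_right)
  qed
  moreover have "0 < c1 + c2" using 1 2 by simp
  ultimately show ?thesis using e(1) unfolding descends_def by blast
qed

lemma descends_add_0: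
  fixes w :: "'n::finite heis \<Rightarrow> real"
  assumes "open \<Omega>" "continuous_on \<Omega> w" "p \<in> \<Omega>" "descends w p h" "k = 0 \<or> descends w p k"
  shows "descends w p (h + k)"
  using assms(5) descends_add[OF assms(1-4)] assms(4) by (elim disjE) simp_all

text \<open>The zero alternative accommodates vanishing weights, as 0 is never a descent
  direction.\<close>

lemma descends_sum:
  fixes w :: "'n::finite heis \<Rightarrow> real"
  assumes "open \<Omega>" "continuous_on \<Omega> w" "p \<in> \<Omega>" "finite T"
    and f: "\<And>k. k \<in> T \<Longrightarrow> f k = 0 \<or> descends w p (f k)"
  shows "sum f T = 0 \<or> descends w p (sum f T)"
  using assms(4) f
proof (induction T)
  case (insert k T)
  have "f k = 0 \<or> descends w p (f k)"
    using insert.prems by simp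
  moreover have "sum f T = 0 \<or> descends w p (sum f T)"
    using insert.prems by (intro insert.IH) simp
  ultimately have "f k + sum f T = 0 \<or> descends w p (f k + sum f T)"
    using descends_add[OF assms(1-3), of "f k" "sum f T"] by (elim disjE) simp_all
  then show ?case using insert.hyps by simp
qed simp

text \<open>By continuity the drop along \<open>h\<close> exceeds half its value at \<open>p\<close>
  for all nearby base points, and H-convexity gives at least the fraction \<open>s\<close> of the
  drop at parameter \<open>s\<close>.\<close>

lemma H_convex_descends:
  fixes w :: "'n::finite heis \<Rightarrow> real"
  assumes "open \<Omega>" "continuous_on \<Omega> w" "H_convex_on \<Omega> w"
    and "p \<in> \<Omega>" "hshift p h \<in> \<Omega>" "w (hshift p h) < w p"
  shows "descends w p h"
proof -
  define c where "c = (w p - w (hshift p h)) / 2"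
  have c: "0 < c" using assms by (simp add: c_def)
  define A where "A = \<Omega> \<inter> (\<lambda>q. hshift q h) -` \<Omega>"
  have "open A"
    unfolding A_def by (intro open_Int open_vimage assms continuous_intros)
  have "p \<in> A" using assms by (simp add: A_def)
  have "continuous_on A (\<lambda>q. w q - w (hshift q h))"
  proof (intro continuous_intros)
    show "continuous_on A w" using assms(2) by (rule continuous_on_subset) (auto simp: A_def)
    show "continuous_on A (\<lambda>q. w (hshift q h))"
      by (rule continuous_on_compose2[OF assms(2)]) (auto simp: A_def intro!: continuous_intros)
  qed
  then have "open (A \<inter> (\<lambda>q. w q - w (hshift q h)) -` {c<..})"
    using \<open>open A\<close> continuous_open_preimage open_greaterThan by blast
  moreover have "p \<in> A \<inter> (\<lambda>q. w q - w (hshift q h)) -` {c<..}"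
    using \<open>p \<in> A\<close> c by (simp add: c_def)
  ultimately obtain e where e: "0 < e" "ball p e \<subseteq> A \<inter> (\<lambda>q. w q - w (hshift q h)) -` {c<..}"
    using openE by blast
  have "w (hshift q (s *\<^sub>R h)) \<le> w q - c * s"
    if q: "q \<in> ball p (min e 1)" and s: "s \<in> {0..min e 1}" for q s
  proof -
    have q': "q \<in> \<Omega>" "hshift q h \<in> \<Omega>" "c < w q - w (hshift q h)" using q e by (auto simp: A_def)
    have "w (hshift q (s *\<^sub>R h)) \<le> (1 - s) * w q + s * w (hshift q h)"
      using s q' by (intro H_convex_onD[OF assms(3)]) auto
    also have "\<dots> = w q - (w q - w (hshift q h)) * s" by (simp add: algebra_simps)
    also have "\<dots> \<le> w q - c * s"
      using q' s by (intro diff_left_mono mult_right_mono) auto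
    finally show ?thesis .
  qed
  then show ?thesis unfolding descends_def using c e(1)
    by (intro exI[of _ c] exI[of _ "min e 1"] conjI) auto
qed


section \<open>Horizontal sections and minima through Brouwer's theorem\<close>

definition hslice :: "'n::finite heis set \<Rightarrow> 'n heis \<Rightarrow> ((real^'n) \<times> (real^'n)) set" where
  "hslice S p = {h. hshift p h \<in> S}"

lemma closed_hslice: "closed S \<Longrightarrow> closed (hslice S p)"
  unfolding hslice_def vimage_def[symmetric] by (intro closed_vimage continuous_intros)

lemma open_hslice: "open S \<Longrightarrow> open (hslice S p)"
  unfolding hslice_def vimage_def[symmetric] by (intro open_vimage continuous_intros)

lemma convex_hslice:
  assumes "convex S"
  shows "convex (hslice S p)"
  unfolding convex_alt
proof (intro ballI allI impI)
  fix h k and l :: real assume "h \<in> hslice S p" "k \<in> hslice S p" and "0 \<le> l \<and> l \<le> 1"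
  then have "(1 - l) *\<^sub>R hshift p h + l *\<^sub>R hshift p k \<in> S"
    using assms unfolding convex_alt hslice_def by blast
  then show "(1 - l) *\<^sub>R h + l *\<^sub>R k \<in> hslice S p"
    by (simp add: hslice_def hshift_affine)
qed

text \<open>If there is no such \<open>p\<close>, gluing descent directions gives a continuous field \<open>X\<close> on the
  horizontal section through \<open>q\<close> which is a descent direction at every interior point and points to
  \<open>q\<close> on the boundary; such a field has no zero, contradicting Brouwer's theorem for
  the projection of \<open>j + X j\<close> to the section.\<close>
lemma ex_horizontal_minimum:
  fixes w :: "'n::finite heis \<Rightarrow> real"
  assumes op: "open \<Omega>" and conv: "convex \<Omega>" and cont: "continuous_on (closure \<Omega>) w"
    and Hconv: "H_convex_on \<Omega> w" and q: "q \<in> \<Omega>"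
    and bdd: "bounded (hslice (closure \<Omega>) q)"
    and bd: "\<And>h. hshift q h \<in> frontier \<Omega> \<Longrightarrow> w q < w (hshift q h)"
  shows "\<exists>p\<in>\<Omega> \<inter> hplane q. \<forall>p'\<in>\<Omega> \<inter> hplane p. w p \<le> w p'"
proof (rule ccontr)
  assume none: "\<not> ?thesis"
  define g where "g = hshift q"
  define K where "K = hslice (closure \<Omega>) q"
  have gK: "j \<in> K \<longleftrightarrow> g j \<in> closure \<Omega>" for j by (simp add: K_def g_def hslice_def)
  have contw: "continuous_on \<Omega> w"
    using cont closure_subset by (rule continuous_on_subset)
  have contg: "continuous_on A g" for A
    unfolding g_def by (intro continuous_intros)
  have contwg: "continuous_on K (\<lambda>j. w (g j))"
    by (rule continuous_on_compose2[OF cont contg]) (auto simp: gK)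
  have K: "compact K" "convex K" "0 \<in> K"
    using bdd q conv closure_subset[of \<Omega>]
    by (auto simp: K_def compact_eq_bounded_closed closed_hslice convex_hslice convex_closure)
      (auto simp: hslice_def)
  have descent: "\<exists>h. descends w (g j) h" if "g j \<in> \<Omega>" for j
  proof -
    have "g j \<in> \<Omega> \<inter> hplane q" using that by (simp add: g_def)
    then obtain p' where p': "p' \<in> \<Omega>" "p' \<in> hplane (g j)" "w p' < w (g j)"
      using none unfolding not_le[symmetric] by blast
    then obtain h where "p' = hshift (g j) h" using hplaneE by blast
    with p' have "descends w (g j) h"
      using H_convex_descends[OF op contw Hconv that] by blast
    then show ?thesis ..
  qed
  define dir where "dir j = (SOME h. descends w (g j) h)" for j
  have dir: "descends w (g j) (dir j)" if "g j \<in> \<Omega>" for j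
    unfolding dir_def using descent[OF that] by (rule someI_ex)
  \<comment> \<open>The open set of parameters at which the direction chosen for \<open>k\<close>
    still descends.\<close>
  define U where "U k = {j. g j \<in> \<Omega> \<and> descends w (g j) (dir k)}" for k
  have openU: "open (U k)" for k
  proof -
    have "U k = g -` (\<Omega> \<inter> {p. descends w p (dir k)})" by (auto simp: U_def)
    then show ?thesis
      using open_vimage[OF open_Int[OF op open_descends] contg] by simp
  qed
  \<comment> \<open>Boundary values exceed \<open>w q\<close>, so this compact sublevel set stays
    inside the domain and finitely many \<open>U k\<close> cover it.\<close>
  define L where "L = {j \<in> K. w (g j) \<le> w q}"
  have LO: "g j \<in> \<Omega>" if "j \<in> L" for j
    using that bd[of j] op by (force simp: L_def gK g_def frontier_def interior_open)
  have "compact L"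
  proof -
    have "closedin (top_of_set K) (K \<inter> (\<lambda>j. w (g j)) -` {..w q})"
      using contwg closed_atMost by (rule continuous_closedin_preimage)
    also have "K \<inter> (\<lambda>j. w (g j)) -` {..w q} = L" by (auto simp: L_def)
    finally have "closedin (top_of_set K) L" .
    then show ?thesis using K(1) closedin_compact by blast
  qed
  moreover have "L \<subseteq> (\<Union>k\<in>L. U k)" using LO dir by (auto simp: U_def)
  ultimately obtain T where T: "T \<subseteq> L" "finite T" "L \<subseteq> (\<Union>k\<in>T. U k)"
    using compactE_image[of L L U] openU by metis
  \<comment> \<open>The first term is active exactly off \<open>L\<close>, where moving towards
    \<open>q\<close> lowers \<open>w\<close>; on \<open>L\<close> some weight
    \<open>infdist j (- U k)\<close> is positive. The weights are continuous and vanish outside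
    \<open>U k\<close>.\<close>
  define X where "X j = max 0 (w (g j) - w q) *\<^sub>R (- j) + (\<Sum>k\<in>T. infdist j (- U k) *\<^sub>R dir k)" for j
  have contX: "continuous_on K X"
    unfolding X_def by (intro continuous_intros contwg)
  have contP: "continuous_on K (\<lambda>j. closest_point K (j + X j))"
    by (rule continuous_on_compose2[OF continuous_on_closest_point[of K UNIV]])
      (use K in \<open>auto intro!: continuous_intros contX compact_imp_closed\<close>)
  have Kne: "K \<noteq> {}" using K(3) by auto
  have PK: "(\<lambda>j. closest_point K (j + X j)) \<in> K \<rightarrow> K"
    using K Kne by (auto intro!: closest_point_in_set compact_imp_closed)
  obtain j where j: "j \<in> K" "closest_point K (j + X j) = j"
    by (rule brouwer[OF K(1,2) Kne contP PK])
  \<comment> \<open>Since \<open>j\<close> is the point of \<open>K\<close> closest to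
    \<open>j + X j\<close>, the vector \<open>X j\<close> lies in the normal cone of
    \<open>K\<close> at \<open>j\<close>.\<close>
  have dot: "X j \<bullet> (y - j) \<le> 0" if "y \<in> K" for y
    using any_closest_point_dot[of K j y "j + X j"] closest_point_exists(2)[of K "j + X j"] j that K
    by (auto simp: compact_imp_closed)
  \<comment> \<open>\<open>infdist\<close> to the empty set is 0 by convention, so positivity of the
    weights on \<open>U k\<close> requires a nonempty complement.\<close>
  have Uc: "- U k \<noteq> {}" for k
  proof
    assume "- U k = {}"
    then have "K = UNIV"
      using closure_subset[of \<Omega>] by (auto simp: U_def gK)
    then show False using K(1) not_bounded_UNIV compact_imp_bounded by metis
  qed
  have weight: "infdist j (- U k) = 0 \<longleftrightarrow> j \<notin> U k" for k
    using in_closed_iff_infdist_zero[of "- U k" j] openU[of k] Uc[of k] by (simp add: closed_Compl)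
  show False
  proof (cases "g j \<in> \<Omega>")
    case True
    have "j \<in> interior K"
    proof (rule interiorI)
      show "open (hslice \<Omega> q)" using op by (rule open_hslice)
      show "j \<in> hslice \<Omega> q" using True by (simp add: hslice_def g_def)
      show "hslice \<Omega> q \<subseteq> K" using closure_subset[of \<Omega>] by (auto simp: hslice_def K_def)
    qed
    then obtain e where e: "0 < e" "cball j e \<subseteq> K" using mem_interior_cball by blast
    \<comment> \<open>At an interior point of \<open>K\<close> the normal cone is trivial.\<close>
    have X0: "X j = 0"
    proof (rule ccontr)
      assume X: "X j \<noteq> 0"
      have "j + (e / norm (X j)) *\<^sub>R X j \<in> cball j e" using X e by (simp add: dist_norm)
      then have "X j \<bullet> ((e / norm (X j)) *\<^sub>R X j) \<le> 0"
        using dot[of "j + (e / norm (X j)) *\<^sub>R X j"] e(2) by auto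
      moreover have "0 < X j \<bullet> ((e / norm (X j)) *\<^sub>R X j)" using X e by simp
      ultimately show False by simp
    qed
    have smd: "infdist j (- U k) *\<^sub>R dir k = 0 \<or> descends w (g j) (infdist j (- U k) *\<^sub>R dir k)" for k
    proof (cases "j \<in> U k")
      case True
      then have "0 < infdist j (- U k)" using weight[of k] infdist_nonneg[of j "- U k"] by linarith
      moreover have "descends w (g j) (dir k)" using True by (simp add: U_def)
      ultimately show ?thesis using descends_scaleR by blast
    qed (use weight in simp)
    have sum: "(\<Sum>k\<in>A. infdist j (- U k) *\<^sub>R dir k) = 0 \<or>
        descends w (g j) (\<Sum>k\<in>A. infdist j (- U k) *\<^sub>R dir k)" if "finite A" for A
      by (rule descends_sum[OF op contw True that]) (rule smd)
    have "descends w (g j) (X j)"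
    proof (cases "w (g j) \<le> w q")
      case True
      then have "j \<in> L" using j by (simp add: L_def)
      then obtain k where k: "k \<in> T" "j \<in> U k" using T by blast
      have "descends w (g j) (dir k)" using k(2) by (simp add: U_def)
      then have "dir k \<noteq> 0" using not_descends_0 by metis
      moreover have "infdist j (- U k) \<noteq> 0" using k(2) weight[of k] by simp
      ultimately have "infdist j (- U k) *\<^sub>R dir k \<noteq> 0" by simp
      then have "descends w (g j) (infdist j (- U k) *\<^sub>R dir k)"
        using smd[of k] by simp
      \<comment> \<open>One nonzero summand is split off as a genuine descent direction; the rest
        may vanish.\<close>
      moreover have "X j = infdist j (- U k) *\<^sub>R dir k + (\<Sum>k\<in>T - {k}. infdist j (- U k) *\<^sub>R dir k)"
        using True by (simp add: X_def sum.remove[OF T(2) k(1)])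
      ultimately show ?thesis
        using descends_add_0[OF op contw \<open>g j \<in> \<Omega>\<close> _ sum[of "T - {k}"]] T(2) by simp
    next
      case False
      have gq: "hshift (g j) (- j) = q" by (simp add: g_def)
      have "descends w (g j) (- j)"
        by (rule H_convex_descends[OF op contw Hconv True]) (use q False in \<open>simp_all add: gq\<close>)
      then have "descends w (g j) (max 0 (w (g j) - w q) *\<^sub>R (- j))"
        using False by (intro descends_scaleR) auto
      then show ?thesis
        unfolding X_def by (rule descends_add_0[OF op contw True _ sum[OF T(2)]])
    qed
    then show False using X0 not_descends_0 by metis
  next
    case False
    then have fr: "g j \<in> frontier \<Omega>" using j gK op by (simp add: frontier_def interior_open)
    then have less: "w q < w (g j)" using bd by (simp add: g_def)
    have "infdist j (- U k) = 0" for k using weight False by (simp add: U_def)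
    then have "X j = (w (g j) - w q) *\<^sub>R (- j)" using less by (simp add: X_def)
    \<comment> \<open>On the frontier only the first term of \<open>X\<close> survives; testing the
      normal cone condition with \<open>0 \<in> K\<close> forces \<open>j = 0\<close>, that is,
      \<open>g j = q\<close>.\<close>
    then have "(w (g j) - w q) * (j \<bullet> j) \<le> 0" using dot[OF K(3)] by simp
    then have "j \<bullet> j \<le> 0" using less by (simp add: mult_le_0_iff)
    then have "j = 0" by (metis inner_eq_zero_iff inner_ge_zero order_antisym)
    then show False using False q by (simp add: g_def)
  qed
qed

section \<open>Measuring the horizontal normal mapping\<close>

lemma subdiffH_iff:
  "v \<in> subdiffH \<Omega> u p \<longleftrightarrow> (\<forall>h. hshift p h \<in> \<Omega> \<longrightarrow> u p + v \<bullet> h \<le> u (hshift p h))"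
proof -
  have "v \<in> subdiffH \<Omega> u p \<longleftrightarrow> (\<forall>q\<in>range (hshift p). q \<in> \<Omega> \<longrightarrow> u p + v \<bullet> (Pr1 q - Pr1 p) \<le> u q)"
    unfolding subdiffH_def hplane_eq by blast
  then show ?thesis by simp
qed

lemma closed_hplane: "closed (hplane p)"
proof -
  have "hplane p = {q. snd (snd q) = snd (snd p) + 2 * (fst q \<bullet> fst (snd p) - fst p \<bullet> fst (snd q))}"
    by (auto simp: hplane_def split: prod.splits)
  also have "closed \<dots>" by (intro closed_Collect_eq continuous_intros)
  finally show ?thesis .
qed

text \<open>Base points subconverge in the compact set \<open>C\<close>. For a fixed displacement
  \<open>h\<close> the subgradient inequality passes to the limit, since the shifted points
  eventually lie in the open set \<open>\<Omega>\<close>.\<close>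

lemma closed_subdiffH_set:
  fixes u :: "'n::finite heis \<Rightarrow> real"
  assumes "open \<Omega>" "continuous_on \<Omega> u" "compact C" "C \<subseteq> \<Omega>"
  shows "closed (subdiffH_set \<Omega> u C)"
  unfolding closed_sequential_limits
proof (intro allI impI)
  fix v l assume "(\<forall>n. v n \<in> subdiffH_set \<Omega> u C) \<and> v \<longlonglongrightarrow> l"
  then have v: "\<And>n. \<exists>p\<in>C. v n \<in> subdiffH \<Omega> u p" "v \<longlonglongrightarrow> l"
    by (auto simp: subdiffH_set_def)
  then obtain p where p: "\<And>n. p n \<in> C" "\<And>n. v n \<in> subdiffH \<Omega> u (p n)"
    by metis
  obtain a r where a: "a \<in> C" "strict_mono r" "(p \<circ> r) \<longlonglongrightarrow> a"
    using assms(3) p(1) unfolding compact_def by blast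
  have lim_u: "(\<lambda>n. u (f n)) \<longlonglongrightarrow> u b" if "f \<longlonglongrightarrow> b" "b \<in> \<Omega>" for f b
    using that assms(1,2) continuous_on_eq_continuous_at isCont_tendsto_compose by blast
  have u_lim: "(\<lambda>n. u ((p \<circ> r) n) + (v \<circ> r) n \<bullet> h) \<longlonglongrightarrow> u a + l \<bullet> h" for h
  proof -
    have "(\<lambda>n. u ((p \<circ> r) n)) \<longlonglongrightarrow> u a"
      using a(1) assms(4) by (intro lim_u[OF a(3)]) auto
    moreover have "(v \<circ> r) \<longlonglongrightarrow> l"
      using v(2) a(2) by (rule LIMSEQ_subseq_LIMSEQ)
    ultimately show ?thesis by (intro tendsto_intros)
  qed
  have "u a + l \<bullet> h \<le> u (hshift a h)" if h: "hshift a h \<in> \<Omega>" for h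
  proof (rule LIMSEQ_le[OF u_lim])
    have *: "(\<lambda>n. hshift ((p \<circ> r) n) h) \<longlonglongrightarrow> hshift a h"
      by (rule continuous_on_tendsto_compose[of UNIV "\<lambda>p. hshift p h", OF _ a(3)])
        (auto intro!: continuous_intros)
    show "(\<lambda>n. u (hshift ((p \<circ> r) n) h)) \<longlonglongrightarrow> u (hshift a h)" by (rule lim_u[OF * h])
    have "eventually (\<lambda>n. hshift ((p \<circ> r) n) h \<in> \<Omega>) sequentially"
      using * assms(1) h by (rule topological_tendstoD)
    then show "\<exists>N. \<forall>n\<ge>N. u ((p \<circ> r) n) + (v \<circ> r) n \<bullet> h \<le> u (hshift ((p \<circ> r) n) h)"
      using p(2) unfolding eventually_sequentially subdiffH_iff comp_def by blast
  qed
  then show "l \<in> subdiffH_set \<Omega> u C"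
    using a(1) by (auto simp: subdiffH_set_def subdiffH_iff)
qed

text \<open>Exhausting \<open>\<Omega>\<close> by compact sets gives a countable union of closed
  sets. Measurability matters because \<open>emeasure\<close> is 0 on non-measurable sets.\<close>

lemma subdiffH_set_sets_lebesgue:
  fixes u :: "'n::finite heis \<Rightarrow> real"
  assumes "open \<Omega>" "continuous_on \<Omega> u"
  shows "subdiffH_set \<Omega> u (\<Omega> \<inter> hplane q) \<in> sets lebesgue"
proof -
  obtain C where C: "range C \<subseteq> Collect compact" "\<And>n::nat. C n \<subseteq> \<Omega>" "\<Omega> = (\<Union>n. C n)"
  proof -
    obtain C :: "nat \<Rightarrow> 'n heis set" where "\<And>n. compact (C n)" "\<And>n. C n \<subseteq> \<Omega>" "\<Union>(range C) = \<Omega>"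
      using open_Union_compact_subsets[OF assms(1)] by metis
    then show ?thesis by (intro that[of C]) auto
  qed
  have "subdiffH_set \<Omega> u (\<Omega> \<inter> hplane q) = (\<Union>n. subdiffH_set \<Omega> u (C n \<inter> hplane q))"
    unfolding subdiffH_set_def C(3) by auto
  moreover have "closed (subdiffH_set \<Omega> u (C n \<inter> hplane q))" for n
    using C by (intro closed_subdiffH_set assms compact_Int_closed closed_hplane) auto
  ultimately show ?thesis
    by (simp only:) (intro sets.countable_UN; force intro: borel_closed sets_completionI_sets)
qed

text \<open>Centres at odd multiples of \<open>r\<close> on one ray are at least
  \<open>2 * r\<close> apart, so the open balls are disjoint and their volumes add up.\<close>

lemma emeasure_chain_of_balls:
  fixes \<nu> :: "'a::euclidean_space"
  assumes "norm \<nu> = 1" "0 < r" "S \<in> sets lebesgue"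
    and S: "\<And>k. k < N \<Longrightarrow> ball (((2 * real k + 1) * r) *\<^sub>R \<nu>) r \<subseteq> S"
  shows "ennreal (real N * (unit_ball_vol (real DIM('a)) * r ^ DIM('a))) \<le> emeasure lebesgue S"
proof -
  define c where "c k = ((2 * real k + 1) * r) *\<^sub>R \<nu>" for k
  have "disjoint_family_on (\<lambda>k. ball (c k) r) {..<N}"
    unfolding disjoint_family_on_def
  proof (intro ballI impI)
    fix k l :: nat assume "k \<noteq> l"
    have "c k - c l = (2 * (real k - real l) * r) *\<^sub>R \<nu>"
      by (simp add: c_def algebra_simps)
    then have "dist (c k) (c l) = \<bar>2 * (real k - real l) * r\<bar>"
      using assms(1) unfolding dist_norm by simp
    also have "\<dots> = 2 * \<bar>real k - real l\<bar> * r"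
      using assms(2) unfolding abs_mult by simp
    finally have "dist (c k) (c l) = 2 * \<bar>real k - real l\<bar> * r" .
    moreover have "1 \<le> \<bar>real k - real l\<bar>" using \<open>k \<noteq> l\<close> by linarith
    ultimately have "r + r \<le> dist (c k) (c l)" using assms(2) by simp
    then show "ball (c k) r \<inter> ball (c l) r = {}" by (rule disjoint_ballI)
  qed
  then have "emeasure lebesgue (\<Union>k<N. ball (c k) r) = (\<Sum>k<N. emeasure lebesgue (ball (c k) r))"
    by (intro sum_emeasure[symmetric]) auto
  also have "\<dots> = (\<Sum>k<N. ennreal (unit_ball_vol (real DIM('a)) * r ^ DIM('a)))"
    using assms(2) by (intro sum.cong) (simp_all add: emeasure_ball)
  also have "\<dots> = ennreal (real N * (unit_ball_vol (real DIM('a)) * r ^ DIM('a)))"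
    using assms(2) by (simp add: ennreal_mult ennreal_of_nat_eq_real_of_nat)
  finally show ?thesis
    using S assms(3) by (metis (no_types, lifting) UN_least c_def emeasure_mono lessThan_iff)
qed

lemma H_convex_on_subset: "H_convex_on T u \<Longrightarrow> S \<subseteq> T \<Longrightarrow> H_convex_on S u"
  unfolding H_convex_on_def by blast

text \<open>\<open>Pr1\<close> turns the group combination of two points into a convex combination,
  so the subtracted term satisfies the inequality with equality.\<close>

lemma H_convex_on_diff_linear:
  assumes "H_convex_on S u"
  shows "H_convex_on S (\<lambda>p. u p - v \<bullet> (Pr1 p - a))"
proof -
  have "Pr1 (heis_mult p (heis_dil l (heis_mult (heis_inv p) q))) = (1 - l) *\<^sub>R Pr1 p + l *\<^sub>R Pr1 q"
    for p q :: "'a heis" and l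
    by (cases p rule: heis_pt_cases; cases q rule: heis_pt_cases)
      (simp add: heis_inv_pt heis_mult_pt heis_dil_pt algebra_simps)
  note Pr1_comb = this
  show ?thesis unfolding H_convex_on_def
  proof (intro ballI allI impI)
    fix p q l assume "p \<in> S" "q \<in> S" and *: "p \<in> hplane q" "0 \<le> (l::real)" "l \<le> 1"
    then have "u (heis_mult p (heis_dil l (heis_mult (heis_inv p) q))) \<le> (1 - l) * u p + l * u q"
      using assms unfolding H_convex_on_def by blast
    then show "u (heis_mult p (heis_dil l (heis_mult (heis_inv p) q)))
          - v \<bullet> (Pr1 (heis_mult p (heis_dil l (heis_mult (heis_inv p) q))) - a)
        \<le> (1 - l) * (u p - v \<bullet> (Pr1 p - a)) + l * (u q - v \<bullet> (Pr1 q - a))"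
      unfolding Pr1_comb by (simp add: inner_diff_right inner_add_right algebra_simps)
  qed
qed

section \<open>The Dirichlet problem\<close>

locale H_convex_dirichlet =
  fixes \<Omega> :: "'n::finite heis set" and u :: "'n heis \<Rightarrow> real"
  assumes open_dom: "open \<Omega>" and convex_dom: "convex \<Omega>" and horiz_bounded_dom: "horiz_bounded \<Omega>"
    and continuous_u: "continuous_on (closure \<Omega>) u" and H_convex_u: "H_convex_on (closure \<Omega>) u"
    and u_frontier: "\<And>p. p \<in> frontier \<Omega> \<Longrightarrow> u p = 0"
begin

section \<open>Horizontal diameter and rays to the frontier\<close>

lemma frontier_not_dom: "p \<in> frontier \<Omega> \<Longrightarrow> p \<notin> \<Omega>"
  using open_dom by (simp add: frontier_def interior_open)

lemma dom_closure: "p \<in> \<Omega> \<Longrightarrow> p \<in> closure \<Omega>"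
  using closure_subset by blast

lemma frontier_closure: "p \<in> frontier \<Omega> \<Longrightarrow> p \<in> closure \<Omega>"
  by (simp add: frontier_def)

text \<open>\<open>diamH\<close> and \<open>diamHS\<close> are suprema of reals and dominate their
  members only once bounded; the constant \<open>M\<close> of horizontal boundedness bounds
  both.\<close>

lemma norm_le_diamHS_dom:
  assumes "p \<in> \<Omega>" "hshift p h \<in> \<Omega>"
  shows "norm h \<le> diamHS \<Omega>"
proof -
  obtain M where M: "\<And>p a b. p \<in> \<Omega> \<Longrightarrow> a \<in> \<Omega> \<inter> hplane p \<Longrightarrow> b \<in> \<Omega> \<inter> hplane p \<Longrightarrow> dH a b \<le> M"
    using horiz_bounded_dom unfolding horiz_bounded_def by blast
  have self: "p \<in> hplane p" for p :: "'n heis"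
    using hshift_in_hplane[of p 0] by simp
  have bdd: "bdd_above ((\<lambda>ab. dH (fst ab) (snd ab)) ` ((\<Omega> \<inter> hplane p) \<times> (\<Omega> \<inter> hplane p)))"
    if "p \<in> \<Omega>" for p
    using M[OF that] by (intro bdd_aboveI2[of _ _ M]) auto
  have diam_le: "diamH (\<Omega> \<inter> hplane p) \<le> M" if "p \<in> \<Omega>" for p
    unfolding diamH_def using that self[of p] M[OF that]
    by (intro cSUP_least) auto
  have "norm h = dH (fst (p, hshift p h)) (snd (p, hshift p h))" by simp
  also have "\<dots> \<le> diamH (\<Omega> \<inter> hplane p)"
    unfolding diamH_def using assms self[of p] by (intro cSUP_upper bdd) auto
  also have "\<dots> \<le> diamHS \<Omega>"
    unfolding diamHS_def using assms(1) diam_le by (intro cSUP_upper bdd_aboveI2[of _ _ M]) auto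
  finally show ?thesis .
qed

text \<open>An open segment from an interior point of a convex set to a point of its closure stays
  in the interior.\<close>

lemma hshift_scaleR_in_dom:
  assumes "p \<in> \<Omega>" "hshift p h \<in> closure \<Omega>" "0 < l" "l < 1"
  shows "hshift p (l *\<^sub>R h) \<in> \<Omega>"
proof (cases "hshift p h = p")
  case True
  then have "h = 0" using Pr1_hshift[of p h] by simp
  then show ?thesis using assms by simp
next
  case False
  then have "hshift p (l *\<^sub>R h) \<in> open_segment p (hshift p h)"
    using assms unfolding hshift_convex_comb in_segment by metis
  then show ?thesis
    using in_interior_closure_convex_segment[OF convex_dom _ assms(2), of p] assms(1) open_dom
    by (auto simp: interior_open)
qed

lemma norm_le_diamHS:
  assumes "p \<in> \<Omega>" "hshift p h \<in> closure \<Omega>"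
  shows "norm h \<le> diamHS \<Omega>"
proof (rule field_le_mult_one_interval)
  fix l :: real assume l: "0 < l" "l < 1"
  then show "l * norm h \<le> diamHS \<Omega>"
    using norm_le_diamHS_dom[OF assms(1) hshift_scaleR_in_dom[OF assms l]] by simp
qed

lemma ex_frontier_hshift:
  assumes "p \<in> \<Omega>" "h \<noteq> 0"
  obtains s where "0 < s" "hshift p (s *\<^sub>R h) \<in> frontier \<Omega>"
proof -
  \<comment> \<open>The displacement \<open>b *\<^sub>R h\<close> is longer than the horizontal
    diameter, so the ray has left \<open>\<Omega>\<close> by then and has crossed the
    frontier.\<close>
  define b where "b = (\<bar>diamHS \<Omega>\<bar> + 1) / norm h"
  have b: "0 < b" "b * norm h = \<bar>diamHS \<Omega>\<bar> + 1" using assms(2) by (simp_all add: b_def add_nonneg_pos)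
  let ?S = "(\<lambda>s. hshift p (s *\<^sub>R h)) ` {0..b}"
  have "?S \<inter> frontier \<Omega> \<noteq> {}"
  proof (rule connected_Int_frontier)
    show "connected ?S"
      by (intro connected_continuous_image continuous_intros) auto
    have "p \<in> ?S" using b(1) by (intro image_eqI[of _ _ 0]) auto
    then show "?S \<inter> \<Omega> \<noteq> {}" using assms(1) by blast
    have "hshift p (b *\<^sub>R h) \<notin> \<Omega>"
      using norm_le_diamHS_dom[OF assms(1), of "b *\<^sub>R h"] b by auto
    moreover have "hshift p (b *\<^sub>R h) \<in> ?S" using b(1) by (intro imageI) simp
    ultimately show "?S - \<Omega> \<noteq> {}" by blast
  qed
  then obtain s where s: "0 \<le> s" "hshift p (s *\<^sub>R h) \<in> frontier \<Omega>" by auto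
  have "s \<noteq> 0"
  proof
    assume "s = 0"
    with s(2) have "p \<in> frontier \<Omega>" by simp
    then show False using frontier_not_dom assms(1) by blast
  qed
  then have "0 < s" using s(1) by simp
  then show ?thesis using s(2) by (rule that)
qed

section \<open>Sign of \<open>u\<close> and a Harnack inequality\<close>

lemma One_nonzero: "(One :: (real^'n) \<times> (real^'n)) \<noteq> 0"
  using One_non_0 by blast

text \<open>Following \<open>One\<close> and \<open>- One\<close>, \<open>p\<close> lies on a
  horizontal segment between two frontier points, where \<open>u\<close> vanishes;
  \<open>One\<close> stands for any nonzero direction.\<close>

lemma u_nonpos:
  assumes "p \<in> \<Omega>"
  shows "u p \<le> 0"
proof -
  obtain a where a: "0 < a" "hshift p (a *\<^sub>R One) \<in> frontier \<Omega>"
    using ex_frontier_hshift[OF assms One_nonzero] .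
  obtain b where b: "0 < b" "hshift p (b *\<^sub>R (- One)) \<in> frontier \<Omega>"
    using ex_frontier_hshift[OF assms, of "- One"] One_nonzero by auto
  define q where "q = hshift p ((- b) *\<^sub>R One)"
  have q: "q \<in> frontier \<Omega>" using b by (simp add: q_def)
  have qa: "hshift q ((a + b) *\<^sub>R One) = hshift p (a *\<^sub>R One)"
    unfolding q_def by (subst hshift_hshift_scaleR) simp
  have "u (hshift q ((b / (a + b)) *\<^sub>R ((a + b) *\<^sub>R One)))
      \<le> (1 - b / (a + b)) * u q + (b / (a + b)) * u (hshift q ((a + b) *\<^sub>R One))"
    using a b q by (intro H_convex_onD[OF H_convex_u]) (auto simp: qa frontier_closure)
  also have "\<dots> = 0" using a q by (simp add: qa u_frontier)
  also have "(b / (a + b)) *\<^sub>R ((a + b) *\<^sub>R One) = b *\<^sub>R One" using a b by simp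
  also have "hshift q (b *\<^sub>R One) = p"
    unfolding q_def by (subst hshift_hshift_scaleR) simp
  finally show ?thesis .
qed

text \<open>The point is the midpoint of a horizontal segment whose far end has a nonpositive
  value.\<close>

lemma half_step:
  assumes "p \<in> \<Omega>" "hshift p (2 *\<^sub>R h) \<in> \<Omega>"
  shows "u (hshift p h) \<le> u p / 2"
proof -
  have "u (hshift p ((1/2) *\<^sub>R (2 *\<^sub>R h))) \<le> (1 - 1/2) * u p + (1/2) * u (hshift p (2 *\<^sub>R h))"
    using assms by (intro H_convex_onD[OF H_convex_u]) (auto simp: dom_closure)
  then show ?thesis using u_nonpos[OF assms(2)] by simp
qed

text \<open>Five horizontal half-steps lead from \<open>p\<close> to any point of the ball: four sides of a square
  spanning the vertical displacement \<open>t\<close>, then \<open>z\<close>. Each step and its double stay in \<open>\<Omega>\<close>.\<close>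
lemma harnack:
  assumes r: "0 < r"
    and box: "\<And>z t. norm z \<le> 2 * r / 3 \<Longrightarrow> \<bar>t\<bar> \<le> r\<^sup>2 / 3 \<Longrightarrow> heis_mult p (heis_pt z t) \<in> \<Omega>"
    and z: "norm z \<le> r / 3" and t: "\<bar>t\<bar> \<le> r\<^sup>2 / 9"
  shows "u (heis_mult p (heis_pt z t)) \<le> u p / 32"
proof -
  let ?P = "\<lambda>z t. heis_mult p (heis_pt z t)"
  \<comment> \<open>The last two conditions place the end of the doubled step in the box as
    well.\<close>
  have step: "u (?P (z + h) (t + 2 * sympl z h)) \<le> u (?P z t) / 2"
    if "norm z \<le> 2 * r / 3" "\<bar>t\<bar> \<le> r\<^sup>2 / 3"
      "norm (z + 2 *\<^sub>R h) \<le> 2 * r / 3" "\<bar>t + 4 * sympl z h\<bar> \<le> r\<^sup>2 / 3" for z t h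
    using half_step[of "?P z t" h] that box by (simp add: hshift_mult_pt sympl_linear)
  define e :: "real^'n" where "e = axis undefined 1"
  \<comment> \<open>A loop with sides \<open>a\<close>, \<open>b\<close>, \<open>- a\<close>,
    \<open>- b\<close> lifts by \<open>4 * sympl a b\<close>; side \<open>\<alpha>\<close> makes
    this equal to \<open>t\<close>, with the sign in \<open>b\<close> fixing the
    orientation.\<close>
  define \<alpha> where "\<alpha> = sqrt \<bar>t\<bar> / 2"
  define a where "a = (\<alpha> *\<^sub>R e, 0 :: real^'n)"
  define b where "b = (0 :: real^'n, (- sgn t * \<alpha>) *\<^sub>R e)"
  have e: "e \<bullet> e = 1" "norm e = 1" by (simp_all add: e_def inner_axis_axis)
  have \<alpha>: "0 \<le> \<alpha>" "\<alpha>\<^sup>2 = \<bar>t\<bar> / 4" by (simp_all add: \<alpha>_def power_divide)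
  have \<alpha>r: "\<alpha> \<le> r / 6"
  proof (rule power2_le_imp_le)
    show "\<alpha>\<^sup>2 \<le> (r / 6)\<^sup>2" using t by (simp add: \<alpha> power_divide)
  qed (use r in simp)
  have ab: "sympl a b = t / 4"
    using \<alpha>(2) by (simp add: sympl_def a_def b_def e power2_eq_square mult.assoc abs_sgn)
  have ba: "sympl b a = - (t / 4)" using ab sympl_commute[of b a] by simp
  have na: "norm a \<le> r / 6"
    using \<alpha> \<alpha>r by (simp add: a_def norm_prod_def e)
  have nb: "norm b \<le> r / 6"
    using \<alpha> \<alpha>r r by (simp add: b_def norm_prod_def e abs_mult abs_sgn_eq)
  have t2: "\<bar>t\<bar> \<le> r\<^sup>2 / 9" "0 \<le> r\<^sup>2" using t by simp_all
  have tri: "norm (x + y) \<le> norm x + norm y" "norm (x - y) \<le> norm x + norm y" for x y :: "(real^'n) \<times> (real^'n)"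
    by (simp_all add: norm_triangle_ineq norm_triangle_ineq4)
  have 1: "u (?P a 0) \<le> u (?P 0 0) / 2"
    using step[of 0 0 a] na r by simp
  have 2: "u (?P (a + b) (t / 2)) \<le> u (?P a 0) / 2"
    using step[of a 0 b] na nb tri(1)[of a "2 *\<^sub>R b"] t2 r by (simp add: ab)
  have 3: "u (?P b t) \<le> u (?P (a + b) (t / 2)) / 2"
    using step[of "a + b" "t / 2" "- a"] na nb tri[of a b] tri(2)[of b a] t2 r
    by (simp add: ba sympl_linear scaleR_2 algebra_simps)
  have 4: "u (?P 0 t) \<le> u (?P b t) / 2"
    using step[of b t "- b"] nb t2 r by (simp add: sympl_linear scaleR_2)
  have 5: "u (?P z t) \<le> u (?P 0 t) / 2"
    using step[of 0 t z] z t2 r by simp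
  have "?P 0 0 = p" using hshift_0[of p] by (simp add: hshift_def)
  then show ?thesis using 1 2 3 4 5 by simp
qed

section \<open>Boxes and gauge balls inside the domain\<close>

lemma frontier_nonempty: "p \<in> \<Omega> \<Longrightarrow> frontier \<Omega> \<noteq> {}"
  using ex_frontier_hshift[OF _ One_nonzero] by blast

lemma distH_frontier_pos:
  assumes "p \<in> \<Omega>"
  shows "0 < distH p (frontier \<Omega>)"
proof -
  have cont: "continuous_on UNIV (\<lambda>x. heis_mult p (heis_pt (fst x) (snd x)))"
    by (intro continuous_intros)
  have "open ((\<lambda>x. heis_mult p (heis_pt (fst x) (snd x))) -` \<Omega>)"
    using open_vimage[OF open_dom cont] .
  moreover have "0 \<in> (\<lambda>x. heis_mult p (heis_pt (fst x) (snd x))) -` \<Omega>"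
    using assms hshift_0[of p] by (simp add: hshift_def)
  ultimately obtain d where d: "0 < d" "ball 0 d \<subseteq> (\<lambda>x. heis_mult p (heis_pt (fst x) (snd x))) -` \<Omega>"
    using openE by blast
  \<comment> \<open>With \<open>\<rho> \<le> 1\<close>, a vertical coordinate below
    \<open>\<rho>\<^sup>2\<close> is also below \<open>\<rho>\<close>; the half of \<open>d\<close>
    allows for the two coordinates.\<close>
  define \<rho> where "\<rho> = min 1 (d / 2)"
  have \<rho>: "0 < \<rho>" "\<rho> \<le> 1" "\<rho> \<le> d / 2" using d by (auto simp: \<rho>_def)
  have "\<rho> \<le> dH p \<zeta>" if "\<zeta> \<in> frontier \<Omega>" for \<zeta>
  proof (rule ccontr)
    assume "\<not> \<rho> \<le> dH p \<zeta>"
    obtain z t where zt: "heis_mult (heis_inv p) \<zeta> = heis_pt z t" by (rule heis_pt_cases)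
    then have \<zeta>: "\<zeta> = heis_mult p (heis_pt z t)" by (metis heis_mult_inv_cancel)
    have less: "norm z ^ 4 + t\<^sup>2 < \<rho> ^ 4"
      using \<open>\<not> \<rho> \<le> dH p \<zeta>\<close> \<rho>(1) by (simp add: \<zeta> dH_mult_left not_le gauge_pt_less_iff)
    have "norm z ^ 4 < \<rho> ^ 4" using less by (smt (verit) zero_le_power2)
    then have z: "norm z < \<rho>" using \<rho>(1) power_less_imp_less_base by fastforce
    have "t\<^sup>2 < \<rho> ^ 4" using less zero_le_power[OF norm_ge_zero, of z 4] by linarith
    then have "\<bar>t\<bar>\<^sup>2 < (\<rho>\<^sup>2)\<^sup>2" by simp
    then have "\<bar>t\<bar> < \<rho>\<^sup>2" by (rule power_less_imp_less_base) simp
    also have "\<dots> \<le> \<rho> * 1" unfolding power2_eq_square using \<rho> by (intro mult_left_mono) auto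
    finally have "norm (z, t) < d" using z \<rho> norm_Pair_le[of z t] by simp
    then have "\<zeta> \<in> \<Omega>" using d(2) by (auto simp: \<zeta>)
    then show False using that frontier_not_dom by blast
  qed
  then have "\<rho> \<le> distH p (frontier \<Omega>)"
    unfolding distH_def using frontier_nonempty[OF assms] by (intro cINF_greatest) auto
  then show ?thesis using \<rho> by simp
qed

text \<open>The dilation curve from \<open>p\<close> to the point would otherwise meet the frontier,
  at a gauge distance from \<open>p\<close> no larger than that of its endpoint.\<close>

lemma gauge_less_in_dom:
  assumes "p \<in> \<Omega>" "norm z ^ 4 + t\<^sup>2 < distH p (frontier \<Omega>) ^ 4"
  shows "heis_mult p (heis_pt z t) \<in> \<Omega>"
proof (rule ccontr)
  assume notin: "heis_mult p (heis_pt z t) \<notin> \<Omega>"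
  let ?f = "\<lambda>s::real. heis_mult p (heis_pt (s *\<^sub>R z) (s\<^sup>2 * t))"
  have "?f ` {0..1} \<inter> frontier \<Omega> \<noteq> {}"
  proof (rule connected_Int_frontier)
    show "connected (?f ` {0..1})"
      by (intro connected_continuous_image continuous_intros) auto
    have "p = ?f 0" using hshift_0[of p] by (simp add: hshift_def)
    then show "?f ` {0..1} \<inter> \<Omega> \<noteq> {}" using assms(1) by force
    have "?f 1 \<notin> \<Omega>" using notin by simp
    moreover have "?f 1 \<in> ?f ` {0..1}" by (intro imageI) simp
    ultimately show "?f ` {0..1} - \<Omega> \<noteq> {}" by blast
  qed
  then obtain s where s: "0 \<le> s" "s \<le> 1" "?f s \<in> frontier \<Omega>" by auto
  have "distH p (frontier \<Omega>) \<le> dH p (?f s)"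
    unfolding distH_def using s(3) by (intro cINF_lower bdd_belowI2[of _ 0]) auto
  moreover have "norm (s *\<^sub>R z) ^ 4 + (s\<^sup>2 * t)\<^sup>2 = s ^ 4 * (norm z ^ 4 + t\<^sup>2)"
    using s(1) by (simp add: power_mult_distrib algebra_simps)
  moreover have "s ^ 4 * (norm z ^ 4 + t\<^sup>2) \<le> 1 * (norm z ^ 4 + t\<^sup>2)"
    using s by (intro mult_right_mono power_le_one) auto
  ultimately show False
    using assms(2) gauge_pt_less_iff[OF distH_frontier_pos[OF assms(1)], of "s *\<^sub>R z" "s\<^sup>2 * t"]
    by (simp add: dH_mult_left)
qed

text \<open>The box lies in the open gauge ball because
  \<open>(2/3)^4 + (1/3)^2 = 25/81 < 1\<close>.\<close>

lemma box_in_dom: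
  assumes "p \<in> \<Omega>" "norm z \<le> 2 * distH p (frontier \<Omega>) / 3" "\<bar>t\<bar> \<le> (distH p (frontier \<Omega>))\<^sup>2 / 3"
  shows "heis_mult p (heis_pt z t) \<in> \<Omega>"
proof (rule gauge_less_in_dom[OF assms(1)])
  let ?r = "distH p (frontier \<Omega>)"
  have "norm z ^ 4 \<le> (2 * ?r / 3) ^ 4" using assms(2) by (intro power_mono) auto
  then have "norm z ^ 4 \<le> 16 / 81 * ?r ^ 4" by (simp add: power_divide power_mult_distrib)
  moreover have "\<bar>t\<bar>\<^sup>2 \<le> (?r\<^sup>2 / 3)\<^sup>2" using assms(3) by (intro power_mono) auto
  then have "t\<^sup>2 \<le> 1 / 9 * ?r ^ 4" by (simp add: power_divide)
  moreover have "0 < ?r ^ 4" using distH_frontier_pos[OF assms(1)] by simp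
  ultimately show "norm z ^ 4 + t\<^sup>2 < ?r ^ 4" by linarith
qed

text \<open>Since the gauge is continuous, the Euclidean closure stays within the closed gauge
  ball.\<close>

lemma closure_ballH_cases:
  assumes "0 < r" "q \<in> closure (ballH p (r / 3))"
  obtains z t where "q = heis_mult p (heis_pt z t)" "norm z \<le> r / 3" "\<bar>t\<bar> \<le> r\<^sup>2 / 9"
proof -
  have "closed ((\<lambda>q. gauge (heis_mult (heis_inv p) q)) -` {..r / 3})"
    by (intro closed_vimage continuous_on_compose2[OF continuous_on_gauge[of UNIV]] continuous_intros) auto
  moreover have "ballH p (r / 3) \<subseteq> (\<lambda>q. gauge (heis_mult (heis_inv p) q)) -` {..r / 3}"
    by (auto simp: ballH_def dH_def)
  ultimately have "closure (ballH p (r / 3)) \<subseteq> (\<lambda>q. gauge (heis_mult (heis_inv p) q)) -` {..r / 3}"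
    by (rule closure_minimal[rotated])
  then have le: "gauge (heis_mult (heis_inv p) q) \<le> r / 3" using assms(2) by auto
  obtain z t where zt: "heis_mult (heis_inv p) q = heis_pt z t" by (rule heis_pt_cases)
  then have q: "q = heis_mult p (heis_pt z t)" by (metis heis_mult_inv_cancel)
  have *: "norm z ^ 4 + t\<^sup>2 \<le> (r / 3) ^ 4" using le assms(1) unfolding zt by (subst (asm) gauge_pt_le_iff) auto
  have "norm z ^ 4 \<le> (r / 3) ^ 4" using * zero_le_power2[of t] by linarith
  then have "norm z ^ Suc 3 \<le> (r / 3) ^ Suc 3" by simp
  then have "norm z \<le> r / 3" by (rule power_le_imp_le_base) (use assms(1) in simp)
  moreover have "t\<^sup>2 \<le> (r / 3) ^ 4"
    using * zero_le_power[OF norm_ge_zero, of z 4] by linarith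
  then have "\<bar>t\<bar> ^ Suc 1 \<le> (r\<^sup>2 / 9) ^ Suc 1"
    by (simp add: power_divide flip: power2_eq_square)
  then have "\<bar>t\<bar> \<le> r\<^sup>2 / 9" by (rule power_le_imp_le_base) simp
  ultimately show ?thesis using q that by blast
qed

text \<open>A horizontal step of length at most a third of the distance, taken from the closed ball,
  ends in the box around \<open>p\<close>. This makes \<open>DH\<close> positive.\<close>

lemma distH_frontier_hplane_ge:
  assumes "p \<in> \<Omega>" "q \<in> closure (ballH p (distH p (frontier \<Omega>) / 3))" "\<zeta> \<in> frontier \<Omega> \<inter> hplane q"
  shows "distH p (frontier \<Omega>) / 3 \<le> dH q \<zeta>"
proof (rule ccontr)
  let ?r = "distH p (frontier \<Omega>)"
  have r: "0 < ?r" using distH_frontier_pos[OF assms(1)] .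
  assume neg: "\<not> ?r / 3 \<le> dH q \<zeta>"
  obtain z t where q: "q = heis_mult p (heis_pt z t)" and zt: "norm z \<le> ?r / 3" "\<bar>t\<bar> \<le> ?r\<^sup>2 / 9"
    using closure_ballH_cases[OF r assms(2)] .
  obtain h where \<zeta>: "\<zeta> = hshift q h" using assms(3) hplaneE by blast
  have h: "norm h \<le> ?r / 3" using neg by (simp add: \<zeta>)
  have "\<bar>sympl z h\<bar> \<le> norm z * norm h" by (rule abs_sympl_le)
  also have "\<dots> \<le> ?r / 3 * (?r / 3)" using zt(1) h r by (intro mult_mono) auto
  finally have "\<bar>t + 2 * sympl z h\<bar> \<le> ?r\<^sup>2 / 3" using zt(2) abs_triangle_ineq[of t "2 * sympl z h"] by (simp add: power2_eq_square abs_mult)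
  moreover have "norm (z + h) \<le> 2 * ?r / 3" using norm_triangle_ineq[of z h] zt(1) h by simp
  ultimately have "heis_mult p (heis_pt (z + h) (t + 2 * sympl z h)) \<in> \<Omega>"
    by (intro box_in_dom assms(1))
  then have "\<zeta> \<in> \<Omega>" by (simp add: \<zeta> q hshift_mult_pt)
  then show False using assms(3) frontier_not_dom by blast
qed

section \<open>Slopes attained on a section and the final estimate\<close>

text \<open>Subtracting the affine function of slope \<open>v\<close> leaves frontier values above
  the value at \<open>q\<close>. A minimum over its own horizontal plane is then a point with
  subgradient \<open>v\<close>.\<close>

lemma in_subdiffH_set:
  assumes q: "q \<in> \<Omega>" and v: "\<And>h. hshift q h \<in> frontier \<Omega> \<Longrightarrow> v \<bullet> h < - u q"
  shows "v \<in> subdiffH_set \<Omega> u (\<Omega> \<inter> hplane q)"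
proof -
  define w where "w p = u p - v \<bullet> (Pr1 p - Pr1 q)" for p
  have "\<exists>p\<in>\<Omega> \<inter> hplane q. \<forall>p'\<in>\<Omega> \<inter> hplane p. w p \<le> w p'"
  proof (rule ex_horizontal_minimum[OF open_dom convex_dom _ _ q])
    show "continuous_on (closure \<Omega>) w"
      unfolding w_def by (intro continuous_intros continuous_u)
    show "H_convex_on \<Omega> w"
      unfolding w_def using H_convex_on_subset[OF H_convex_u closure_subset] by (rule H_convex_on_diff_linear)
    show "bounded (hslice (closure \<Omega>) q)"
      unfolding bounded_iff hslice_def using norm_le_diamHS[OF q] by blast
    show "w q < w (hshift q h)" if "hshift q h \<in> frontier \<Omega>" for h
      using v[OF that] u_frontier[OF that] by (simp add: w_def)
  qed
  then obtain p where p: "p \<in> \<Omega> \<inter> hplane q" "\<And>p'. p' \<in> \<Omega> \<inter> hplane p \<Longrightarrow> w p \<le> w p'"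
    by blast
  have "u p + v \<bullet> h \<le> u (hshift p h)" if "hshift p h \<in> \<Omega>" for h
    using p(2)[of "hshift p h"] that by (simp add: w_def algebra_simps inner_diff_right inner_add_right)
  then have "v \<in> subdiffH \<Omega> u p" unfolding subdiffH_iff by blast
  then show ?thesis using p(1) unfolding subdiffH_set_def by blast
qed

text \<open>A hyperplane through the section coordinate space separates the open convex section from
  \<open>h0\<close>; its unit normal has support value at most
  \<open>\<nu> \<bullet> h0 \<le> norm h0\<close>. Scaling extends the bound to the closure.\<close>

lemma support_direction:
  assumes q: "q \<in> \<Omega>" and h0: "hshift q h0 \<in> frontier \<Omega>"
  obtains \<nu> where "norm \<nu> = 1" "\<And>h. hshift q h \<in> closure \<Omega> \<Longrightarrow> \<nu> \<bullet> h \<le> norm h0"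
proof -
  have "convex (hslice \<Omega> q)" using convex_dom by (rule convex_hslice)
  moreover have "hslice \<Omega> q \<noteq> {}" using q unfolding hslice_def by (metis hshift_0 empty_Collect_eq)
  moreover have "hslice \<Omega> q \<inter> {h0} = {}" using frontier_not_dom[OF h0] by (auto simp: hslice_def)
  ultimately obtain a b where a: "a \<noteq> 0" "\<forall>h\<in>hslice \<Omega> q. a \<bullet> h \<le> b" "\<forall>h\<in>{h0}. b \<le> a \<bullet> h"
    using separating_hyperplane_sets[of "hslice \<Omega> q" "{h0}"] by auto
  define \<nu> where "\<nu> = (1 / norm a) *\<^sub>R a"
  have \<nu>: "norm \<nu> = 1" using a(1) by (simp add: \<nu>_def)
  have "\<nu> \<bullet> h \<le> norm h0" if h: "hshift q h \<in> closure \<Omega>" for h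
  proof (rule field_le_mult_one_interval)
    fix l :: real assume l: "0 < l" "l < 1"
    have "a \<bullet> (l *\<^sub>R h) \<le> a \<bullet> h0"
    proof -
      have "l *\<^sub>R h \<in> hslice \<Omega> q" using hshift_scaleR_in_dom[OF q h l] by (simp add: hslice_def)
      then have "a \<bullet> (l *\<^sub>R h) \<le> b" using a(2) by blast
      then show ?thesis using a(3) by simp
    qed
    then have "\<nu> \<bullet> (l *\<^sub>R h) \<le> \<nu> \<bullet> h0"
      using a(1) by (simp add: \<nu>_def divide_right_mono)
    also have "\<dots> \<le> norm \<nu> * norm h0" by (rule norm_cauchy_schwarz)
    finally show "l * (\<nu> \<bullet> h) \<le> norm h0" by (simp add: \<nu>)
  qed
  then show ?thesis using \<nu> that by blast
qed

lemma section_estimate: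
  assumes q: "q \<in> \<Omega>" "u q < 0" and h0: "hshift q h0 \<in> frontier \<Omega>"
  shows "ennreal ((- u q) ^ (2 * CARD('n)))
    \<le> ennreal (2 * 4 ^ (2 * CARD('n)) / unit_ball_vol (real (2 * CARD('n)))
          * norm h0 * diamHS \<Omega> ^ (2 * CARD('n) - 1)) * LHS_subdiff \<Omega> u"
proof -
  define D where "D = 2 * CARD('n)"
  define V where "V = unit_ball_vol (real D)"
  define m where "m = - u q"
  define d where "d = norm h0"
  define R where "R = diamHS \<Omega>"
  \<comment> \<open>The slope part along \<open>\<nu>\<close> contributes at most
    \<open>m / 2\<close> and the ball radius at most \<open>r * R = m / 4\<close>, leaving the total
    below \<open>m\<close>.\<close>
  define r where "r = m / (4 * R)"
  \<comment> \<open>As \<open>d \<le> R\<close>, rounding down loses at most half of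
    \<open>R / d\<close>; for \<open>k < N\<close> the centre coefficient stays within
    \<open>2 * (R / d) * r\<close>.\<close>
  define N where "N = nat \<lfloor>R / d\<rfloor>"
  have D: "0 < D" "DIM((real^'n) \<times> (real^'n)) = D" by (simp_all add: D_def)
  have V: "0 < V" by (simp add: V_def)
  have m: "0 < m" using q by (simp add: m_def)
  have "h0 \<noteq> 0" using h0 q(1) frontier_not_dom by (metis hshift_0)
  then have d: "0 < d" by (simp add: d_def)
  have dR: "d \<le> R" using norm_le_diamHS[OF q(1) frontier_closure[OF h0]] by (simp add: d_def R_def)
  then have R: "0 < R" using d by simp
  have r: "0 < r" "r * R = m / 4" using m R by (simp_all add: r_def)
  have N: "real N \<le> R / d" "R / (2 * d) \<le> real N"
  proof -
    have "1 \<le> R / d" using d dR by simp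
    then have "1 \<le> \<lfloor>R / d\<rfloor>" by (simp only: le_floor_iff of_int_1)
    then have *: "real N \<le> R / d" "R / d < real N + 1" "1 \<le> real N" unfolding N_def by linarith+
    then show "real N \<le> R / d" by simp
    have "R / (2 * d) = (R / d) / 2" by simp
    then show "R / (2 * d) \<le> real N" using * by linarith
  qed
  obtain \<nu> where \<nu>: "norm \<nu> = 1" "\<And>h. hshift q h \<in> closure \<Omega> \<Longrightarrow> \<nu> \<bullet> h \<le> d"
    using support_direction[OF q(1) h0] unfolding d_def by metis
  let ?S = "subdiffH_set \<Omega> u (\<Omega> \<inter> hplane q)"
  have balls: "ball (((2 * real k + 1) * r) *\<^sub>R \<nu>) r \<subseteq> ?S" if k: "k < N" for k
  proof
    fix v assume v: "v \<in> ball (((2 * real k + 1) * r) *\<^sub>R \<nu>) r"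
    define s where "s = (2 * real k + 1) * r"
    define e where "e = v - s *\<^sub>R \<nu>"
    have e: "norm e < r" using v by (simp add: e_def s_def dist_norm norm_minus_commute)
    have "2 * real k + 1 \<le> 2 * (R / d)" using k N(1) by linarith
    then have "s * d \<le> 2 * (R / d) * r * d" unfolding s_def using r d by (intro mult_right_mono) auto
    also have "\<dots> = m / 2" using d r(2) by (simp add: mult.commute)
    finally have sd: "s * d \<le> m / 2" .
    have s0: "0 \<le> s" using r by (simp add: s_def)
    show "v \<in> ?S"
    proof (rule in_subdiffH_set[OF q(1)])
      fix h assume "hshift q h \<in> frontier \<Omega>"
      then have h: "hshift q h \<in> closure \<Omega>" by (rule frontier_closure)
      have "v \<bullet> h = s * (\<nu> \<bullet> h) + e \<bullet> h" by (simp add: e_def inner_diff_left)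
      also have "\<dots> \<le> s * d + norm e * norm h"
        using \<nu>(2)[OF h] s0 by (intro add_mono mult_left_mono norm_cauchy_schwarz)
      also have "\<dots> \<le> m / 2 + r * R"
        using sd e r norm_le_diamHS[OF q(1) h] by (intro add_mono mult_mono) (auto simp: R_def)
      also have "\<dots> < - u q" using r m by (simp add: m_def)
      finally show "v \<bullet> h < - u q" .
    qed
  qed
  have "?S \<in> sets lebesgue"
    using open_dom continuous_on_subset[OF continuous_u closure_subset] by (rule subdiffH_set_sets_lebesgue)
  from emeasure_chain_of_balls[OF \<nu>(1) r(1) this balls]
  have "ennreal (real N * (V * r ^ D)) \<le> emeasure lebesgue ?S"
    by (simp only: D V_def)
  also have "\<dots> \<le> LHS_subdiff \<Omega> u" unfolding LHS_subdiff_def using q(1) by (rule SUP_upper)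
  finally have L: "ennreal (real N * (V * r ^ D)) \<le> LHS_subdiff \<Omega> u" .
  define c where "c = 2 * 4 ^ D / V * d * R ^ (D - 1)"
  have c: "0 \<le> c" using V d R by (simp add: c_def)
  have "R ^ D = R * R ^ (D - 1)" using D(1) by (metis power_eq_if not_gr0)
  \<comment> \<open>\<open>c\<close> is tuned so that the lower bound \<open>R / (2 * d)\<close> for
    \<open>N\<close> gives equality here.\<close>
  then have "m ^ D = c * (R / (2 * d) * (V * r ^ D))"
    using V d R by (simp add: c_def r_def power_divide power_mult_distrib)
  also have "\<dots> \<le> c * (real N * (V * r ^ D))"
    using c N(2) V r by (intro mult_left_mono mult_right_mono) auto
  finally have "ennreal (m ^ D) \<le> ennreal (c * (real N * (V * r ^ D)))" by (rule ennreal_leI)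
  also have "\<dots> = ennreal c * ennreal (real N * (V * r ^ D))"
    using c V r by (intro ennreal_mult) auto
  also have "\<dots> \<le> ennreal c * LHS_subdiff \<Omega> u"
    using L by (rule mult_left_mono) simp
  finally show ?thesis by (simp add: m_def D_def[symmetric] V_def[symmetric] c_def d_def R_def)
qed

lemma maximum_principle:
  assumes p: "p \<in> \<Omega>"
  shows "ennreal (\<bar>u p\<bar> ^ (2 * CARD('n)))
    \<le> ennreal (2 * 128 ^ (2 * CARD('n)) / unit_ball_vol (real (2 * CARD('n)))
          * DH \<Omega> p * diamHS \<Omega> ^ (2 * CARD('n) - 1)) * LHS_subdiff \<Omega> u"
proof -
  define D where "D = 2 * CARD('n)"
  define V where "V = unit_ball_vol (real D)"
  define R where "R = diamHS \<Omega>"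
  define rad where "rad = distH p (frontier \<Omega>)"
  define B where "B = closure (ballH p (rad / 3))"
  define L where "L = LHS_subdiff \<Omega> u"
  \<comment> \<open>The factor 128 is the Harnack constant 32 times the 4 of the section
    estimate.\<close>
  define X where "X = 2 * 128 ^ D / V * R ^ (D - 1)"
  have rad: "0 < rad" using distH_frontier_pos[OF p] by (simp add: rad_def)
  have V: "0 < V" by (simp add: V_def)
  have pB: "p \<in> B"
  proof -
    have "dH p p = 0" using dH_hshift[of p 0] by simp
    then show ?thesis using rad closure_subset by (force simp: B_def ballH_def)
  qed
  have B: "q \<in> \<Omega>" "u q \<le> u p / 32" if qB: "q \<in> B" for q
  proof -
    obtain z t where q: "q = heis_mult p (heis_pt z t)" and zt: "norm z \<le> rad / 3" "\<bar>t\<bar> \<le> rad\<^sup>2 / 9"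
      by (rule closure_ballH_cases[OF rad qB[unfolded B_def]])
    show "u q \<le> u p / 32"
      unfolding q using rad zt box_in_dom[OF p] by (intro harnack) (auto simp: rad_def)
    show "q \<in> \<Omega>"
      unfolding q using rad zt zero_le_power2[of rad] by (intro box_in_dom p) (auto simp: rad_def)
  qed
  have ne: "frontier \<Omega> \<inter> hplane q \<noteq> {}" if "q \<in> B" for q
    using ex_frontier_hshift[OF B(1)[OF that] One_nonzero] hshift_in_hplane by (metis IntI empty_iff)
  have R: "0 < R"
  proof -
    obtain s where s: "0 < s" "hshift p (s *\<^sub>R One) \<in> frontier \<Omega>"
      using ex_frontier_hshift[OF p One_nonzero] .
    have "0 < norm (s *\<^sub>R One :: (real^'n) \<times> (real^'n))" using s(1) One_nonzero by (metis scaleR_eq_0_iff zero_less_norm_iff less_irrefl)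
    also have "\<dots> \<le> R"
      unfolding R_def using norm_le_diamHS[OF p frontier_closure[OF s(2)]] .
    finally show ?thesis .
  qed
  have X: "0 < X" using V R by (simp add: X_def)
  have point: "ennreal (\<bar>u p\<bar> ^ D) \<le> ennreal (X * dH q \<zeta>) * L"
    if q: "q \<in> B" and \<zeta>: "\<zeta> \<in> frontier \<Omega> \<inter> hplane q" for q \<zeta>
  proof (cases "u p = 0")
    case True
    then show ?thesis by (simp add: D_def power_0_left)
  next
    case False
    then have neg: "u q < 0" using B(2)[OF q] u_nonpos[OF p] by simp
    obtain h where h: "\<zeta> = hshift q h" using \<zeta> hplaneE by blast
    have "\<bar>u p\<bar> \<le> 32 * (- u q)" using B(2)[OF q] u_nonpos[OF p] by simp
    then have "\<bar>u p\<bar> ^ D \<le> 32 ^ D * (- u q) ^ D"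
      unfolding power_mult_distrib[symmetric] by (rule power_mono) simp
    then have "ennreal (\<bar>u p\<bar> ^ D) \<le> ennreal (32 ^ D) * ennreal ((- u q) ^ D)"
      using neg by (simp add: ennreal_leI flip: ennreal_mult)
    also have "\<dots> \<le> ennreal (32 ^ D) * (ennreal (2 * 4 ^ D / V * norm h * R ^ (D - 1)) * L)"
      using section_estimate[OF B(1)[OF q] neg, of h] \<zeta>
      by (intro mult_left_mono) (auto simp: h D_def V_def R_def L_def)
    also have "\<dots> = ennreal (32 ^ D * (2 * 4 ^ D / V * norm h * R ^ (D - 1))) * L"
      using V R by (subst ennreal_mult) (simp_all add: mult.assoc)
    also have "32 ^ D * (2 * 4 ^ D / V * norm h * R ^ (D - 1)) = X * dH q \<zeta>"
    proof -
      have "(128::real) ^ D = 32 ^ D * 4 ^ D" by (simp flip: power_mult_distrib)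
      then show ?thesis by (simp add: X_def h)
    qed
    finally show ?thesis .
  qed
  \<comment> \<open>A common lower bound passes through both infima of \<open>DH\<close>, as
    \<open>B\<close> and the frontier sections are nonempty.\<close>
  have DH_ge: "a \<le> DH \<Omega> p" if "\<And>q \<zeta>. q \<in> B \<Longrightarrow> \<zeta> \<in> frontier \<Omega> \<inter> hplane q \<Longrightarrow> a \<le> dH q \<zeta>" for a
    unfolding DH_def distH_def using pB ne that
    by (intro cINF_greatest) (auto simp: B_def rad_def distH_def)
  have "rad / 3 \<le> DH \<Omega> p"
    using distH_frontier_hplane_ge[OF p] unfolding B_def rad_def by (intro DH_ge) (simp add: B_def rad_def)
  \<comment> \<open>Positivity is essential when \<open>L\<close> is infinite, because 0 times
    infinity is 0 in \<open>ennreal\<close>.\<close>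
  then have DH_pos: "0 < DH \<Omega> p" using rad by simp
  have "ennreal (\<bar>u p\<bar> ^ D) \<le> ennreal (X * DH \<Omega> p) * L"
  proof (cases L)
    case (real l)
    have real_point: "\<bar>u p\<bar> ^ D \<le> X * l * dH q \<zeta>"
      if "q \<in> B" "\<zeta> \<in> frontier \<Omega> \<inter> hplane q" for q \<zeta>
      using point[OF that] X real by (simp add: mult_ac flip: ennreal_mult)
    have "\<bar>u p\<bar> ^ D \<le> X * l * DH \<Omega> p"
    \<comment> \<open>If \<open>l = 0\<close> the pointwise bound already forces
      \<open>u p = 0\<close>; otherwise division by \<open>X * l\<close> allows passing to the
      infimum.\<close>
    proof (cases "l = 0")
      case True
      obtain \<zeta> where "\<zeta> \<in> frontier \<Omega> \<inter> hplane p" using ne[OF pB] by blast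
      then show ?thesis using real_point[OF pB] True by simp
    next
      case False
      then have Xl: "0 < X * l" using X real by simp
      have "\<bar>u p\<bar> ^ D / (X * l) \<le> DH \<Omega> p"
        using real_point Xl by (intro DH_ge) (simp add: pos_divide_le_eq mult.commute)
      then show ?thesis using Xl by (simp add: pos_divide_le_eq mult.commute)
    qed
    then have "ennreal (\<bar>u p\<bar> ^ D) \<le> ennreal ((X * DH \<Omega> p) * l)"
      by (intro ennreal_leI) (simp add: mult_ac)
    then show ?thesis using real X DH_pos by (simp add: ennreal_mult)
  next
    case top
    then show ?thesis using X DH_pos by (simp add: ennreal_mult_top)
  qed
  then show ?thesis by (simp add: X_def D_def V_def R_def L_def mult_ac)
qed

end

theorem theorem4p3:
  "\<exists>C>0. \<forall>(\<Omega>::'n::finite heis set) (u::'n heis \<Rightarrow> real).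
     open \<Omega> \<and> convex \<Omega> \<and> horiz_bounded \<Omega> \<and>
     continuous_on (closure \<Omega>) u \<and> H_convex_on (closure \<Omega>) u \<and>
     (\<forall>p\<in>frontier \<Omega>. u p = 0) \<longrightarrow>
     (\<forall>p\<in>\<Omega>. ennreal (\<bar>u p\<bar> ^ (2 * CARD('n)))
        \<le> ennreal (C * DH \<Omega> p * diamHS \<Omega> ^ (2 * CARD('n) - 1)) * LHS_subdiff \<Omega> u)"
proof (intro exI[of _ "2 * 128 ^ (2 * CARD('n)) / unit_ball_vol (real (2 * CARD('n)))"] conjI allI impI ballI)
  fix \<Omega> :: "'n heis set" and u :: "'n heis \<Rightarrow> real" and p
  assume "open \<Omega> \<and> convex \<Omega> \<and> horiz_bounded \<Omega> \<and>
     continuous_on (closure \<Omega>) u \<and> H_convex_on (closure \<Omega>) u \<and> (\<forall>p\<in>frontier \<Omega>. u p = 0)"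
  then interpret H_convex_dirichlet \<Omega> u
    by unfold_locales auto
  assume "p \<in> \<Omega>"
  then show "ennreal (\<bar>u p\<bar> ^ (2 * CARD('n)))
    \<le> ennreal (2 * 128 ^ (2 * CARD('n)) / unit_ball_vol (real (2 * CARD('n)))
          * DH \<Omega> p * diamHS \<Omega> ^ (2 * CARD('n) - 1)) * LHS_subdiff \<Omega> u"
    by (rule maximum_principle)
qed (intro divide_pos_pos mult_pos_pos unit_ball_vol_pos; simp)

end
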